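(* Let $G$ be the pendant graph with nodes $1,2,3,4$ and edges $12,13,23,34$, and let $\Phi$ be the priority policy under which node $3$ gives priority to nodes $1$ and $2$ over node $4$. For $\lambda\in(0,\infty)^4$, the matching queue $(G,\lambda,\Phi)$ is stable if and only if $\lambda\in\mathrm{Ncond}(G)$ and $$\lambda_4<\alpha\lambda_3,\qquad\text{where}\quad \alpha=\left[1+\frac{\lambda_1}{\lambda_3+\lambda_2-\lambda_1}+\frac{\lambda_2}{\lambda_3+\lambda_1-\lambda_2}\right]^{-1}=\frac{\lambda_3^2-(\lambda_1-\lambda_2)^2}{\lambda_3(\lambda_3+\lambda_1+\lambda_2)} .$$
   Context: Matching queue $(G,\lambda,\Phi)$ on a finite simple graph $G=(\mathcal V,\mathcal E)$ ($\mathcal E(i)$ is the set of neighbors of $i$): items of class $i\in\mathcal V$ arrive according to independent Poisson processes with intensities $\lambda_i>0$. An arriving class-$i$ item is matched immediately with exactly one queued item of some class in $\mathcal E(i)$ if there is one (both items leave at once); otherwise it is queued. $Q_i(t)$ is the number of queued class-$i$ items at time $t$. Priority policy: each $\mathcal E(i)$ is given a fixed order, and an arriving class-$i$ item is matched with an item of the first class in this order whose queue is non-empty. (For the pendant graph, adjacent nodes never have simultaneously non-empty queues, so only the ordering at node $3$ of $\{1,2\}$ versus $4$ matters.) $Q$ is a continuous-time Markov chain on $\{z\in\mathbb Z_+^{|\mathcal V|}: z_iz_j=0\text{ for adjacent }i,j\}$; the matching queue is stable if $Q$ is positive recurrent. $\mathrm{Ncond}(G)$ is the set of $\lambda\in(0,\infty)^{|\mathcal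 V|}$ such that $\sum_{i\in\mathcal I}\lambda_i<\sum_{j\in\mathcal E(\mathcal I)}\lambda_j$ for every non-empty independent set $\mathcal I$ of $G$, where $\mathcal E(\mathcal I)$ is the set of nodes adjacent to some node of $\mathcal I$. For the pendant graph it amounts to $\lambda_4<\lambda_3<\lambda_4+\lambda_1+\lambda_2$, $\lambda_4+\lambda_1<\lambda_3+\lambda_2$ and $\lambda_4+\lambda_2<\lambda_3+\lambda_1$; under it $\alpha$ is well defined. *)

theory Defs
  imports "HOL-Probability.Probability"
begin

record 'v ugraph =
  nodes :: "'v set"
  edges :: "'v set set"

definition simple_graph :: "'v ugraph \<Rightarrow> bool" where
  "simple_graph G \<longleftrightarrow> finite (nodes G) \<and> (\<forall>e\<in>edges G. e \<subseteq> nodes G \<and> card e = 2)"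

definition neighbors :: "'v ugraph \<Rightarrow> 'v \<Rightarrow> 'v set" where
  "neighbors G i = {j. {i, j} \<in> edges G}"

definition independent_set :: "'v ugraph \<Rightarrow> 'v set \<Rightarrow> bool" where
  "independent_set G I \<longleftrightarrow> I \<subseteq> nodes G \<and> (\<forall>i\<in>I. \<forall>j\<in>I. {i, j} \<notin> edges G)"

text \<open>
  Rate vectors are functions on the node type; their values outside \<open>nodes G\<close> are never used.
\<close>

definition Ncond :: "'v ugraph \<Rightarrow> ('v \<Rightarrow> real) set" where
  "Ncond G = {rate. (\<forall>i\<in>nodes G. 0 < rate i) \<and>
     (\<forall>I. independent_set G I \<and> I \<noteq> {} \<longrightarrow>
        (\<Sum>i\<in>I. rate i) < (\<Sum>j\<in>(\<Union>i\<in>I. neighbors G i). rate j))}"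

text \<open>
  A priority policy lists the neighbors of each node, highest priority first.
\<close>

definition priority_policy :: "'v ugraph \<Rightarrow> ('v \<Rightarrow> 'v list) \<Rightarrow> bool" where
  "priority_policy G \<Phi> \<longleftrightarrow> (\<forall>i\<in>nodes G. distinct (\<Phi> i) \<and> set (\<Phi> i) = neighbors G i)"

definition queue_states :: "'v ugraph \<Rightarrow> ('v \<Rightarrow> nat) set" where
  "queue_states G = {z. (\<forall>i. i \<notin> nodes G \<longrightarrow> z i = 0) \<and>
     (\<forall>i j. {i, j} \<in> edges G \<longrightarrow> z i = 0 \<or> z j = 0)}"

definition arrive :: "('v \<Rightarrow> 'v list) \<Rightarrow> 'v \<Rightarrow> ('v \<Rightarrow> nat) \<Rightarrow> ('v \<Rightarrow> nat)" where
  "arrive \<Phi> i z = (case find (\<lambda>j. 0 < z j) (\<Phi> i) of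
      None \<Rightarrow> z(i := z i + 1)
    | Some j \<Rightarrow> z(j := z j - 1))"

text \<open>
  The independent Poisson arrival processes are given by their inter-arrival times: coordinate
  \<open>(i, n)\<close> of a sample point \<open>\<omega>\<close> is the time between arrivals \<open>n - 1\<close> and \<open>n\<close> of class \<open>i\<close>
  (the time from \<open>0\<close> to the first arrival if \<open>n = 0\<close>). The coordinates are independent, those of
  class \<open>i\<close> being exponential with parameter \<open>rate i\<close>.
\<close>

definition interarrivals :: "'v ugraph \<Rightarrow> ('v \<Rightarrow> real) \<Rightarrow> ('v \<times> nat \<Rightarrow> real) measure" where
  "interarrivals G rate = (\<Pi>\<^sub>M (i, n)\<in>nodes G \<times> UNIV.
     density lborel (\<lambda>x. ennreal (exponential_density (rate i) x)))"

definition arrival_time :: "('v \<times> nat \<Rightarrow> real) \<Rightarrow> 'v \<Rightarrow> nat \<Rightarrow> real" where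
  "arrival_time \<omega> i n = (\<Sum>k\<le>n. \<omega> (i, k))"

definition arrival_times_upto :: "'v ugraph \<Rightarrow> ('v \<times> nat \<Rightarrow> real) \<Rightarrow> real \<Rightarrow> real set" where
  "arrival_times_upto G \<omega> t = {arrival_time \<omega> i n | i n. i \<in> nodes G \<and> arrival_time \<omega> i n \<le> t}"

definition arriving_class :: "'v ugraph \<Rightarrow> ('v \<times> nat \<Rightarrow> real) \<Rightarrow> real \<Rightarrow> 'v" where
  "arriving_class G \<omega> s = (THE i. i \<in> nodes G \<and> (\<exists>n. arrival_time \<omega> i n = s))"

text \<open>
  The queue process with initial state \<open>z\<close>: all arrivals up to time \<open>t\<close> are handled in
  chronological order. The sample points with simultaneous arrivals, or with infinitely many
  arrivals in bounded time, form a null set; there the value is irrelevant.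
\<close>

definition queue ::
  "'v ugraph \<Rightarrow> ('v \<Rightarrow> 'v list) \<Rightarrow> ('v \<Rightarrow> nat) \<Rightarrow> ('v \<times> nat \<Rightarrow> real) \<Rightarrow> real \<Rightarrow> 'v \<Rightarrow> nat" where
  "queue G \<Phi> z \<omega> t =
     fold (arrive \<Phi>) (map (arriving_class G \<omega>) (sorted_list_of_set (arrival_times_upto G \<omega> t))) z"

text \<open>
  First time at which the path is in its initial state again after having left it
  (\<open>\<infinity>\<close> if there is none).
\<close>

definition return_time :: "(real \<Rightarrow> 's) \<Rightarrow> ennreal" where
  "return_time X =
     (INF t\<in>{t. 0 \<le> t \<and> X t = X 0 \<and> (\<exists>s. 0 \<le> s \<and> s < t \<and> X s \<noteq> X 0)}. ennreal t)"

text \<open>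
  Positive recurrence of the queue process: every state has finite mean return time.
\<close>

definition stable_queue :: "'v ugraph \<Rightarrow> ('v \<Rightarrow> real) \<Rightarrow> ('v \<Rightarrow> 'v list) \<Rightarrow> bool" where
  "stable_queue G rate \<Phi> \<longleftrightarrow>
     (\<forall>z\<in>queue_states G. (\<integral>\<^sup>+\<omega>. return_time (queue G \<Phi> z \<omega>) \<partial>interarrivals G rate) < \<infinity>)"

definition pendant :: "nat ugraph" where
  "pendant = \<lparr>nodes = {1, 2, 3, 4}, edges = {{1, 2}, {1, 3}, {2, 3}, {3, 4}}\<rparr>"

lemma simple_graph_pendant: "simple_graph pendant"
  by (auto simp: simple_graph_def pendant_def)

definition alpha :: "(nat \<Rightarrow> real) \<Rightarrow> real" where
  "alpha rate = inverse (1 + rate 1 / (rate 3 + rate 2 - rate 1) + rate 2 / (rate 3 + rate 1 - rate 2))"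

end

(* Both the jump chain and the arrivals after the first one restart afresh: competing exponentials
   are memoryless. So the mean return time in continuous time is, up to the mean gap between two
   arrivals, a mean hitting time of the jump chain.

   For the jump chain only functions V(z) = sum of a_i z_i are needed. Node 3 serves 4 only while
   1 and 2 are empty; giving nodes 1 and 2 the weights s/(rate 3 + rate 2 - rate 1) and
   s/(rate 3 + rate 1 - rate 2) and node 4 the weight 1, the drift of V is rate 4 - s as long as 1
   or 2 is non-empty, and s / alpha - s + rate 4 - rate 3 when only 4 is queued. With
   s = alpha * rate 3 both equal rate 4 - alpha * rate 3, so V is a Foster function (node 3 gets the
   weight 1). With s = rate 4 and weight 0 on node 3, the first drift vanishes and the second is
   rate 4 / alpha - rate 3. If that is nonnegative, V is a submartingale with bounded increments, so
   that the chain started at x avoids the empty state for n steps with probability at least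
   V x / (V x + c n), whose sum over n diverges. This covers the null recurrent and the transient
   case at once; the other stability conditions are necessary by the same argument, with V z the
   number of items queued at a single node. *)

theory Submission
  imports Defs
begin

section \<open>Product measures and the exponential distribution\<close>

text \<open>While class 4 is queued, the items of classes 1 and 2 form a birth-death chain: class 1
  grows at rate \<open>rate 1\<close> and shrinks at rate \<open>rate 2 + rate 3\<close>, and class
  2 symmetrically. From z items of class 1 the mean time to empty this chain is z /
  (\<open>rate 3 + rate 2 - rate 1\<close>), so the weighted part of V is s times the mean time
  until node 3 is free for node 4. The stationary probability that the chain is empty is
  \<open>alpha rate\<close>, a sum of two geometric series; hence \<open>alpha rate * rate 3\<close>
  is the service left over for node 4. The return time is a function of infinitely many coordinates
  that is never shown to be measurable. Its integral is enclosed between integrals of the truncated,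
  recursively defined and measurable \<open>hit_cost\<close>, since monotonicity of the integral
  asks for no measurability.\<close>

lemma nn_integral_PiM_restrict_finite:
  assumes M: "\<And>k. prob_space (M k)" and L: "finite L" "L \<subseteq> K"
    and [measurable]: "F \<in> borel_measurable (PiM L M)"
  shows "(\<integral>\<^sup>+\<omega>. F (restrict \<omega> L) \<partial>PiM K M) = (\<integral>\<^sup>+\<omega>. F \<omega> \<partial>PiM L M)"
proof -
  interpret product_prob_space M K
    by (intro product_prob_space.intro product_prob_space_axioms.intro product_sigma_finite.intro
        M prob_space_imp_sigma_finite)
  have [measurable]: "(\<lambda>\<omega>. restrict \<omega> L) \<in> measurable (PiM K M) (PiM L M)"
    using L by (intro measurable_restrict_subset) auto
  have "(\<integral>\<^sup>+\<omega>. F \<omega> \<partial>PiM L M) = (\<integral>\<^sup>+\<omega>. F \<omega> \<partial>distr (PiM K M) (PiM L M) (\<lambda>x. restrict x L))"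
    using distr_PiM_restrict_finite[OF L] by simp
  also have "\<dots> = (\<integral>\<^sup>+\<omega>. F (restrict \<omega> L) \<partial>PiM K M)"
    by (subst nn_integral_distr) auto
  finally show ?thesis ..
qed

text \<open>Both orders of integration serve: \<open>a\<close> outermost when the other coordinates
  compete with it, innermost when they are frozen and \<open>a\<close> would have to hit a
  prescribed value.\<close>

lemma nn_integral_PiM_split_coordinate:
  assumes M: "\<And>k. prob_space (M k)" and L: "finite L" "L \<subseteq> K" "a \<in> K" "a \<notin> L"
    and F[measurable]: "(\<lambda>(t, \<omega>). F t \<omega>) \<in> borel_measurable (M a \<Otimes>\<^sub>M PiM L M)"
  shows "(\<integral>\<^sup>+\<omega>. F (\<omega> a) (restrict \<omega> L) \<partial>PiM K M) = (\<integral>\<^sup>+t. \<integral>\<^sup>+\<omega>. F t \<omega> \<partial>PiM L M \<partial>M a)"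
    and "(\<integral>\<^sup>+\<omega>. F (\<omega> a) (restrict \<omega> L) \<partial>PiM K M) = (\<integral>\<^sup>+\<omega>. \<integral>\<^sup>+t. F t \<omega> \<partial>M a \<partial>PiM L M)"
proof -
  interpret product_prob_space M K
    by (intro product_prob_space.intro product_prob_space_axioms.intro product_sigma_finite.intro
        M prob_space_imp_sigma_finite)
  have [measurable]: "(\<lambda>\<omega>. restrict \<omega> L) \<in> measurable (PiM (insert a L) M) (PiM L M)"
    by (intro measurable_restrict_subset) auto
  have [measurable]: "(\<lambda>\<omega>. F (\<omega> a) (restrict \<omega> L)) \<in> borel_measurable (PiM (insert a L) M)"
    using measurable_compose[OF _ F, of "\<lambda>\<omega>. (\<omega> a, restrict \<omega> L)"] by simp
  have eq: "(\<integral>\<^sup>+\<omega>. F (\<omega> a) (restrict \<omega> L) \<partial>PiM K M)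
      = (\<integral>\<^sup>+\<omega>. F (\<omega> a) (restrict \<omega> L) \<partial>PiM (insert a L) M)"
    using L by (subst nn_integral_PiM_restrict_finite[symmetric, OF M])
      (auto simp: Int_absorb1 subset_insertI)
  have r: "restrict (fun_upd \<omega> a t) L = \<omega>" if "\<omega> \<in> space (PiM L M)" for \<omega> t
    using that L by (auto simp: space_PiM PiE_def extensional_def fun_eq_iff restrict_def)
  have r': "restrict \<omega> L = \<omega>" if "\<omega> \<in> space (PiM L M)" for \<omega>
    using that by (simp add: space_PiM PiE_restrict)
  show "(\<integral>\<^sup>+\<omega>. F (\<omega> a) (restrict \<omega> L) \<partial>PiM K M) = (\<integral>\<^sup>+t. \<integral>\<^sup>+\<omega>. F t \<omega> \<partial>PiM L M \<partial>M a)"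
    unfolding eq using L
    by (subst product_nn_integral_insert_rev) (auto simp: r r' intro!: nn_integral_cong)
  show "(\<integral>\<^sup>+\<omega>. F (\<omega> a) (restrict \<omega> L) \<partial>PiM K M) = (\<integral>\<^sup>+\<omega>. \<integral>\<^sup>+t. F t \<omega> \<partial>M a \<partial>PiM L M)"
    unfolding eq using L
    by (subst product_nn_integral_insert) (auto simp: r r' intro!: nn_integral_cong)
qed

text \<open>Given the value t of coordinate \<open>a\<close>, the other coordinates are still
  independent, so the mean of the product factorizes under the outer integral although each factor
  may depend on t.\<close>

lemma nn_integral_PiM_prod:
  fixes f :: "'k \<Rightarrow> 'a \<Rightarrow> 'a \<Rightarrow> ennreal"
  assumes M: "\<And>k. prob_space (M k)" and L: "finite L" "L \<subseteq> K" "a \<in> K" "a \<notin> L"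
    and f: "\<And>k. k \<in> L \<Longrightarrow> (\<lambda>(t, x). f k t x) \<in> borel_measurable (M a \<Otimes>\<^sub>M M k)"
  shows "(\<integral>\<^sup>+\<omega>. (\<Prod>k\<in>L. f k (\<omega> a) (\<omega> k)) \<partial>PiM K M) =
    (\<integral>\<^sup>+t. (\<Prod>k\<in>L. \<integral>\<^sup>+x. f k t x \<partial>M k) \<partial>M a)"
proof -
  interpret product_prob_space M K
    by (intro product_prob_space.intro product_prob_space_axioms.intro product_sigma_finite.intro
        M prob_space_imp_sigma_finite)
  have [measurable]: "(\<lambda>(t, \<omega>). \<Prod>k\<in>L. f k t (\<omega> k)) \<in> borel_measurable (M a \<Otimes>\<^sub>M PiM L M)"
  proof -
    have "(\<lambda>(t, \<omega>). f k t (\<omega> k)) \<in> borel_measurable (M a \<Otimes>\<^sub>M PiM L M)" if "k \<in> L" for k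
      using that measurable_compose[OF _ f[OF that], of "\<lambda>(t, \<omega>). (t, \<omega> k)"]
      by (simp add: case_prod_beta)
    then show ?thesis
      by (simp add: case_prod_beta borel_measurable_prod_ennreal)
  qed
  have "(\<integral>\<^sup>+\<omega>. (\<Prod>k\<in>L. f k (\<omega> a) (\<omega> k)) \<partial>PiM K M)
      = (\<integral>\<^sup>+\<omega>. (\<Prod>k\<in>L. f k (\<omega> a) (restrict \<omega> L k)) \<partial>PiM K M)"
    by simp
  also have "\<dots> = (\<integral>\<^sup>+t. \<integral>\<^sup>+\<omega>. (\<Prod>k\<in>L. f k t (\<omega> k)) \<partial>PiM L M \<partial>M a)"
    using L by (intro nn_integral_PiM_split_coordinate(1) M) auto
  also have "\<dots> = (\<integral>\<^sup>+t. (\<Prod>k\<in>L. \<integral>\<^sup>+x. f k t x \<partial>M k) \<partial>M a)"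
  proof (intro nn_integral_cong product_nn_integral_prod L)
    fix t k assume "t \<in> space (M a)" "k \<in> L"
    then show "f k t \<in> borel_measurable (M k)"
      using measurable_compose[OF measurable_Pair1' f, of t k] by simp
  qed
  finally show ?thesis .
qed

section \<open>Exponential laws\<close>

definition exp_measure :: "real \<Rightarrow> real measure" where
  "exp_measure l = density lborel (\<lambda>x. ennreal (exponential_density l x))"

lemma sets_exp_measure [measurable_cong, simp]: "sets (exp_measure l) = sets borel"
  by (simp add: exp_measure_def)

lemma space_exp_measure [simp]: "space (exp_measure l) = UNIV"
  by (simp add: exp_measure_def)

lemma prob_space_exp_measure: "0 < l \<Longrightarrow> prob_space (exp_measure l)"
  unfolding exp_measure_def by (rule prob_space_exponential_density)

lemma AE_exp_measure_pos: "AE x in exp_measure l. 0 < x"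
proof -
  have "AE x in lborel. x \<noteq> (0::real)"
    by (rule AE_lborel_singleton)
  then show ?thesis
    unfolding exp_measure_def by (subst AE_density) (auto simp: exponential_density_def)
qed

lemma AE_exp_measure_neq: "AE x in exp_measure l. x \<noteq> c"
proof -
  have "AE x in lborel. x \<noteq> (c::real)"
    by (rule AE_lborel_singleton)
  then show ?thesis
    unfolding exp_measure_def by (subst AE_density) auto
qed

lemma nn_integral_exp_measure:
  "f \<in> borel_measurable borel \<Longrightarrow>
    (\<integral>\<^sup>+x. f x \<partial>exp_measure l) = (\<integral>\<^sup>+x. ennreal (exponential_density l x) * f x \<partial>lborel)"
  unfolding exp_measure_def by (subst nn_integral_density) auto

text \<open>Memorylessness in integral form: on the event x > t, of probability exp(- t l), the
  overshoot x - t has the original law.\<close>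

lemma exp_measure_memoryless:
  assumes "0 < l" "0 \<le> t" and [measurable]: "g \<in> borel_measurable borel"
  shows "(\<integral>\<^sup>+x. indicator {t<..} x * g (x - t) \<partial>exp_measure l) =
    ennreal (exp (- t * l)) * (\<integral>\<^sup>+x. g x \<partial>exp_measure l)"
proof -
  have "(\<integral>\<^sup>+x. indicator {t<..} x * g (x - t) \<partial>exp_measure l)
      = (\<integral>\<^sup>+x. ennreal (exponential_density l x) * (indicator {t<..} x * g (x - t)) \<partial>lborel)"
    by (subst nn_integral_exp_measure) auto
  also have "\<dots> = (\<integral>\<^sup>+x. ennreal (exponential_density l (t + x)) * (indicator {t<..} (t + x) * g x) \<partial>lborel)"
    by (subst nn_integral_real_affine[of _ 1 t]) auto
  also have "\<dots> = (\<integral>\<^sup>+x. ennreal (exp (- t * l)) * (ennreal (exponential_density l x) * g x) \<partial>lborel)"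
  proof (rule nn_integral_cong_AE)
    \<comment> \<open>At x = 0 the strict indicator vanishes but the density does not, so the
      integrands agree only almost everywhere.\<close>
    have "AE x in lborel. x \<noteq> (0::real)"
      by (rule AE_lborel_singleton)
    then show "AE x in lborel. ennreal (exponential_density l (t + x)) * (indicator {t<..} (t + x) * g x)
       = ennreal (exp (- t * l)) * (ennreal (exponential_density l x) * g x)"
    proof eventually_elim
      case (elim x)
      have "exponential_density l (t + x) = exp (- t * l) * exponential_density l x" if "0 < x"
        using that assms by (simp add: exponential_density_def algebra_simps flip: exp_add)
      then have "ennreal (exponential_density l (t + x)) = ennreal (exp (- t * l)) * ennreal (exponential_density l x)" if "0 < x"
        using that assms by (simp add: ennreal_mult exponential_density_nonneg)
      then show ?case
        using elim by (cases "0 < x") (auto simp: exponential_density_def mult.assoc indicator_def)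
    qed
  qed
  also have "\<dots> = ennreal (exp (- t * l)) * (\<integral>\<^sup>+x. g x \<partial>exp_measure l)"
    by (subst nn_integral_cmult) (auto simp: nn_integral_exp_measure)
  finally show ?thesis .
qed

text \<open>The density of parameter l times the integrand is l / (l + r) times the density of
  parameter l + r. This is the probability that a clock of rate l rings before clocks of total rate
  r; with r = 1 it serves as a Laplace transform.\<close>

lemma nn_integral_exp_exp_measure:
  assumes "0 < l" "0 \<le> r"
  shows "(\<integral>\<^sup>+t. ennreal (exp (- t * r)) \<partial>exp_measure l) = ennreal (l / (l + r))"
proof -
  interpret prob_space "exp_measure (l + r)"
    using assms by (intro prob_space_exp_measure) auto
  have "(\<integral>\<^sup>+t. ennreal (exp (- t * r)) \<partial>exp_measure l)
      = (\<integral>\<^sup>+t. ennreal (exponential_density l t) * ennreal (exp (- t * r)) \<partial>lborel)"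
    by (subst nn_integral_exp_measure) auto
  also have "\<dots> = (\<integral>\<^sup>+t. ennreal (l / (l + r)) * (ennreal (exponential_density (l + r) t) * 1) \<partial>lborel)"
  proof (intro nn_integral_cong)
    fix t
    have "exponential_density l t * exp (- t * r) = l / (l + r) * exponential_density (l + r) t"
      using assms by (simp add: exponential_density_def distrib_left flip: exp_add)
    then show "ennreal (exponential_density l t) * ennreal (exp (- t * r))
        = ennreal (l / (l + r)) * (ennreal (exponential_density (l + r) t) * 1)"
      using assms by (simp add: exponential_density_nonneg flip: ennreal_mult)
  qed
  also have "\<dots> = ennreal (l / (l + r)) * (\<integral>\<^sup>+t. 1 \<partial>exp_measure (l + r))"
    unfolding nn_integral_exp_measure[OF borel_measurable_const] by (subst nn_integral_cmult) auto
  also have "(\<integral>\<^sup>+t. 1 \<partial>exp_measure (l + r)) = 1"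
    using emeasure_space_1 by simp
  finally show ?thesis
    by simp
qed

lemma nn_integral_exp_measure_id:
  assumes "0 < l"
  shows "(\<integral>\<^sup>+t. ennreal t \<partial>exp_measure l) < \<infinity>"
proof -
  have "(\<integral>\<^sup>+t. ennreal t \<partial>exp_measure l)
      = (\<integral>\<^sup>+t. ennreal (exponential_density l t) * ennreal t \<partial>lborel)"
    by (subst nn_integral_exp_measure) auto
  also have "\<dots> = (\<integral>\<^sup>+t. ennreal (erlang_density 0 l t * t ^ 1) \<partial>lborel)"
    using assms by (intro nn_integral_cong) (simp add: ennreal_mult' exponential_density_nonneg)
  also have "\<dots> < \<infinity>"
    using assms by (subst nn_integral_erlang_ith_moment) auto
  finally show ?thesis .
qed

section \<open>Sample paths\<close>

text \<open>Absence of ties makes \<open>arriving_class\<close> unambiguous; the other two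
  properties make every \<open>arrival_times_upto\<close> finite, so that
  \<open>sorted_list_of_set\<close> gives the genuine list of arrivals.\<close>

definition regular_arrivals :: "'v ugraph \<Rightarrow> ('v \<times> nat \<Rightarrow> real) \<Rightarrow> bool" where
  "regular_arrivals G \<omega> \<longleftrightarrow> (\<forall>i\<in>nodes G. \<forall>n. 0 < \<omega> (i, n)) \<and>
     (\<forall>i\<in>nodes G. \<forall>j\<in>nodes G. \<forall>m n. i \<noteq> j \<longrightarrow> arrival_time \<omega> i m \<noteq> arrival_time \<omega> j n) \<and>
     (\<forall>i\<in>nodes G. \<forall>t. \<exists>n. t < arrival_time \<omega> i n)"

definition first_arrival :: "'v ugraph \<Rightarrow> 'v \<Rightarrow> ('v \<times> nat \<Rightarrow> real) set" where
  "first_arrival G i = {\<omega>. \<forall>j\<in>nodes G. j \<noteq> i \<longrightarrow> \<omega> (i, 0) < \<omega> (j, 0)}"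

text \<open>The arrivals seen from a first arrival of class i: class i drops one coordinate, every
  other class keeps its residual waiting time. The restriction makes the result a point of the
  product space again.\<close>

definition shift_arrivals :: "'v ugraph \<Rightarrow> 'v \<Rightarrow> ('v \<times> nat \<Rightarrow> real) \<Rightarrow> 'v \<times> nat \<Rightarrow> real" where
  "shift_arrivals G i \<omega> = (\<lambda>(j, n)\<in>nodes G \<times> UNIV.
     if j = i then \<omega> (i, Suc n) else if n = 0 then \<omega> (j, 0) - \<omega> (i, 0) else \<omega> (j, n))"

lemma
  assumes "regular_arrivals G \<omega>" "i \<in> nodes G"
  shows regular_arrivals_pos: "0 < \<omega> (i, n)"
    and regular_arrivals_neq: "j \<in> nodes G \<Longrightarrow> i \<noteq> j \<Longrightarrow> arrival_time \<omega> i m \<noteq> arrival_time \<omega> j n"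
    and regular_arrivals_unbounded: "\<exists>n. t < arrival_time \<omega> i n"
  using assms unfolding regular_arrivals_def by blast+

lemma arrival_time_0 [simp]: "arrival_time \<omega> i 0 = \<omega> (i, 0)"
  by (simp add: arrival_time_def)

lemma arrival_time_Suc: "arrival_time \<omega> i (Suc n) = arrival_time \<omega> i n + \<omega> (i, Suc n)"
  by (simp add: arrival_time_def)

lemma arrival_time_strict_mono:
  "regular_arrivals G \<omega> \<Longrightarrow> i \<in> nodes G \<Longrightarrow> strict_mono (arrival_time \<omega> i)"
  by (simp add: strict_mono_Suc_iff arrival_time_Suc regular_arrivals_def)

lemma arrival_time_shift:
  assumes "i \<in> nodes G" "j \<in> nodes G"
  shows "arrival_time (shift_arrivals G i \<omega>) j n =
    arrival_time \<omega> j (if j = i then Suc n else n) - \<omega> (i, 0)"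
  using assms by (induction n) (auto simp: arrival_time_Suc shift_arrivals_def)

lemma regular_arrivals_shift:
  assumes r: "regular_arrivals G \<omega>" and i: "i \<in> nodes G" and f: "\<omega> \<in> first_arrival G i"
  shows "regular_arrivals G (shift_arrivals G i \<omega>)"
  unfolding regular_arrivals_def
proof (intro conjI ballI allI impI)
  fix j n assume "j \<in> nodes G"
  then show "0 < shift_arrivals G i \<omega> (j, n)"
    using r f by (auto simp: shift_arrivals_def regular_arrivals_def first_arrival_def)
next
  fix j k m n assume "j \<in> nodes G" "k \<in> nodes G" "j \<noteq> k"
  then show "arrival_time (shift_arrivals G i \<omega>) j m \<noteq> arrival_time (shift_arrivals G i \<omega>) k n"
    using r i by (simp add: arrival_time_shift regular_arrivals_neq)
next
  fix j t assume j: "j \<in> nodes G"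
  then obtain n where "t + \<omega> (i, 0) < arrival_time \<omega> j n"
    using regular_arrivals_unbounded[OF r j] by blast
  also have "\<dots> \<le> arrival_time \<omega> j (if j = i then Suc n else n)"
    using arrival_time_strict_mono[OF r j] by (simp add: strict_mono_less_eq)
  finally show "\<exists>n. t < arrival_time (shift_arrivals G i \<omega>) j n"
    using i j by (intro exI[of _ n]) (simp add: arrival_time_shift)
qed

lemma ex_first_arrival:
  assumes r: "regular_arrivals G \<omega>" and "finite (nodes G)" "nodes G \<noteq> {}"
  shows "\<exists>i\<in>nodes G. \<omega> \<in> first_arrival G i"
proof -
  define m where "m = Min ((\<lambda>i. \<omega> (i, 0)) ` nodes G)"
  have "m \<in> (\<lambda>i. \<omega> (i, 0)) ` nodes G"
    unfolding m_def using assms by (intro Min_in) auto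
  then obtain i where i: "i \<in> nodes G" "\<omega> (i, 0) = m"
    by auto
  have "\<omega> (i, 0) < \<omega> (j, 0)" if "j \<in> nodes G" "j \<noteq> i" for j
  proof -
    have "\<omega> (i, 0) \<le> \<omega> (j, 0)"
      using i assms that by (simp add: m_def)
    moreover have "arrival_time \<omega> i 0 \<noteq> arrival_time \<omega> j 0"
      using i that by (intro regular_arrivals_neq[OF r]) auto
    ultimately show ?thesis
      by simp
  qed
  then show ?thesis
    using i by (auto simp: first_arrival_def)
qed

lemma first_arrival_unique:
  "\<omega> \<in> first_arrival G i \<Longrightarrow> \<omega> \<in> first_arrival G j \<Longrightarrow> i \<in> nodes G \<Longrightarrow> j \<in> nodes G \<Longrightarrow> i = j"
  by (force simp: first_arrival_def)

lemma finite_arrival_times_upto: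
  assumes r: "regular_arrivals G \<omega>" and "finite (nodes G)"
  shows "finite (arrival_times_upto G \<omega> t)"
proof -
  have "finite {n. arrival_time \<omega> i n \<le> t}" if i: "i \<in> nodes G" for i
  proof -
    obtain m where m: "t < arrival_time \<omega> i m"
      using regular_arrivals_unbounded[OF r i] by blast
    have "n < m" if "arrival_time \<omega> i n \<le> t" for n
      using m that strict_mono_less[OF arrival_time_strict_mono[OF r i], of n m] by simp
    then show ?thesis
      by (auto intro: finite_subset[of _ "{..<m}"])
  qed
  moreover have "arrival_times_upto G \<omega> t =
      (\<Union>i\<in>nodes G. arrival_time \<omega> i ` {n. arrival_time \<omega> i n \<le> t})"
    by (auto simp: arrival_times_upto_def)
  ultimately show ?thesis
    using assms by auto
qed

lemma first_arrival_le:
  assumes r: "regular_arrivals G \<omega>" and i: "i \<in> nodes G" and f: "\<omega> \<in> first_arrival G i"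
    and j: "j \<in> nodes G"
  shows "\<omega> (i, 0) \<le> arrival_time \<omega> j n"
proof -
  have "\<omega> (i, 0) \<le> \<omega> (j, 0)"
    using f j by (cases "j = i") (auto simp: first_arrival_def less_imp_le)
  also have "\<dots> \<le> arrival_time \<omega> j n"
    using strict_mono_less_eq[OF arrival_time_strict_mono[OF r j], of 0 n] by simp
  finally show ?thesis .
qed

lemma arriving_class_eq:
  assumes r: "regular_arrivals G \<omega>" and i: "i \<in> nodes G"
  shows "arriving_class G \<omega> (arrival_time \<omega> i n) = i"
  unfolding arriving_class_def
  using i regular_arrivals_neq[OF r] by (intro the_equality) metis+

lemma queue_before_first_arrival:
  assumes r: "regular_arrivals G \<omega>" and i: "i \<in> nodes G" and f: "\<omega> \<in> first_arrival G i"
    and t: "t < \<omega> (i, 0)"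
  shows "queue G \<Phi> z \<omega> t = z"
proof -
  have "\<not> arrival_time \<omega> j n \<le> t" if "j \<in> nodes G" for j n
    using first_arrival_le[OF r i f that, of n] t by simp
  then have "arrival_times_upto G \<omega> t = {}"
    by (auto simp: arrival_times_upto_def)
  then show ?thesis
    by (simp add: queue_def)
qed

lemma arrival_times_upto_shift:
  assumes r: "regular_arrivals G \<omega>" and i: "i \<in> nodes G" and f: "\<omega> \<in> first_arrival G i"
    and t: "0 \<le> t"
  shows "arrival_times_upto G \<omega> (\<omega> (i, 0) + t) =
    insert (\<omega> (i, 0)) ((+) (\<omega> (i, 0)) ` arrival_times_upto G (shift_arrivals G i \<omega>) t)"
    (is "?A = insert ?m (_ ` ?B)")
proof (intro set_eqI iffI)
  fix s assume "s \<in> ?A"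
  then obtain j n where j: "j \<in> nodes G" "s = arrival_time \<omega> j n" "s \<le> ?m + t"
    by (auto simp: arrival_times_upto_def)
  show "s \<in> insert ?m ((+) ?m ` ?B)"
  proof (cases "j = i \<and> n = 0")
    case False
    define k where "k = (if j = i then n - 1 else n)"
    have "n = (if j = i then Suc k else k)"
      using False by (auto simp: k_def)
    then have "s = ?m + arrival_time (shift_arrivals G i \<omega>) j k"
      using i j by (simp add: arrival_time_shift)
    then show ?thesis
      using j by (auto simp: arrival_times_upto_def)
  qed (use j in auto)
next
  fix s assume "s \<in> insert ?m ((+) ?m ` ?B)"
  then show "s \<in> ?A"
  proof
    assume "s = ?m"
    then show ?thesis
      using i t by (auto simp: arrival_times_upto_def intro!: exI[of _ i] exI[of _ 0])
  next
    assume "s \<in> (+) ?m ` ?B"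
    then obtain j n where j: "j \<in> nodes G" "s = ?m + arrival_time (shift_arrivals G i \<omega>) j n"
      "arrival_time (shift_arrivals G i \<omega>) j n \<le> t"
      by (auto simp: arrival_times_upto_def)
    then have "s = arrival_time \<omega> j (if j = i then Suc n else n)" "s \<le> ?m + t"
      using i by (simp_all add: arrival_time_shift)
    then show ?thesis
      using j(1) unfolding arrival_times_upto_def by blast
  qed
qed

text \<open>The Markov property path by path: the queue is a fold over the chronological list of
  classes, and this list is i followed by the list of the shifted point.\<close>

lemma queue_after_first_arrival:
  assumes r: "regular_arrivals G \<omega>" and fin: "finite (nodes G)"
    and i: "i \<in> nodes G" and f: "\<omega> \<in> first_arrival G i" and t: "0 \<le> t"
  shows "queue G \<Phi> z \<omega> (\<omega> (i, 0) + t) = queue G \<Phi> (arrive \<Phi> i z) (shift_arrivals G i \<omega>) t"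
proof -
  let ?m = "\<omega> (i, 0)" and ?\<omega>' = "shift_arrivals G i \<omega>"
  let ?B = "arrival_times_upto G ?\<omega>' t"
  note r' = regular_arrivals_shift[OF r i f]
  have fB: "finite ?B"
    by (rule finite_arrival_times_upto[OF r' fin])
  have pos: "0 < s" if "s \<in> ?B" for s
  proof -
    from that obtain j n where j: "j \<in> nodes G" "s = arrival_time ?\<omega>' j n"
      by (auto simp: arrival_times_upto_def)
    have "0 < arrival_time ?\<omega>' j 0"
      using r' j by (simp add: regular_arrivals_def)
    also have "\<dots> \<le> s"
      unfolding j by (simp only: strict_mono_less_eq[OF arrival_time_strict_mono[OF r' j(1)]] le0)
    finally show ?thesis .
  qed
  \<comment> \<open>Positivity of the shifted times puts the first arrival strictly in front, and a
    sorted distinct list is determined by its set.\<close>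
  have "sorted (?m # map ((+) ?m) (sorted_list_of_set ?B))" "distinct (?m # map ((+) ?m) (sorted_list_of_set ?B))"
    using fB pos by (force simp: sorted_map distinct_map less_imp_le)+
  from sorted_list_of_set.idem_if_sorted_distinct[OF this] have list:
    "sorted_list_of_set (arrival_times_upto G \<omega> (?m + t)) = ?m # map ((+) ?m) (sorted_list_of_set ?B)"
    using fB by (simp add: arrival_times_upto_shift[OF r i f t])
  have cls: "arriving_class G \<omega> (?m + s) = arriving_class G ?\<omega>' s" if "s \<in> ?B" for s
  proof -
    from that obtain j n where j: "j \<in> nodes G" "s = arrival_time ?\<omega>' j n"
      by (auto simp: arrival_times_upto_def)
    then have "?m + s = arrival_time \<omega> j (if j = i then Suc n else n)"
      using i by (simp add: arrival_time_shift)
    then show ?thesis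
      using arriving_class_eq[OF r j(1)] arriving_class_eq[OF r' j(1)] j(2) by metis
  qed
  have "map (arriving_class G \<omega>) (map ((+) ?m) (sorted_list_of_set ?B)) =
      map (arriving_class G ?\<omega>') (sorted_list_of_set ?B)"
    unfolding map_map using fB cls by (intro map_cong) auto
  moreover have "arriving_class G \<omega> ?m = i"
    using arriving_class_eq[OF r i, of 0] by simp
  ultimately show ?thesis
    by (simp only: queue_def list list.map fold_Cons comp_apply)
qed

text \<open>\<open>return_time\<close> demands a departure and so has no recursion of its own. After
  the first arrival only this plain hitting time remains, and it satisfies a first-step
  equation.\<close>

definition hitting_time :: "(real \<Rightarrow> 's) \<Rightarrow> 's \<Rightarrow> ennreal" where
  "hitting_time X a = (INF t\<in>{t. 0 \<le> t \<and> X t = a}. ennreal t)"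

lemma INF_ennreal_shift:
  assumes "0 \<le> m" "A \<subseteq> {0..}"
  shows "(INF t\<in>(+) m ` A. ennreal t) = ennreal m + (INF t\<in>A. ennreal t)"
proof -
  have "(INF t\<in>(+) m ` A. ennreal t) = (INF t\<in>A. ennreal m + ennreal t)"
    unfolding image_image using assms by (intro INF_cong) (auto simp: subset_iff)
  also have "\<dots> = ennreal m + (INF t\<in>A. ennreal t)"
  proof (cases "A = {}")
    case False
    then show ?thesis
      using continuous_at_Inf_mono[of "\<lambda>x. ennreal m + x" "ennreal ` A"]
        continuous_add[of "at_right (Inf (ennreal ` A))" "\<lambda>x. ennreal m" "\<lambda>x. x"]
      by (auto simp: mono_def image_image)
  qed simp
  finally show ?thesis .
qed

lemma hitting_time_self:
  assumes "X 0 = a"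
  shows "hitting_time X a = 0"
proof -
  have "hitting_time X a \<le> ennreal 0"
    unfolding hitting_time_def using assms by (intro INF_lower) auto
  then show ?thesis
    by simp
qed

lemma queue_0:
  assumes r: "regular_arrivals G \<omega>" and "finite (nodes G)" "nodes G \<noteq> {}"
  shows "queue G \<Phi> z \<omega> 0 = z"
proof -
  obtain i where i: "i \<in> nodes G" "\<omega> \<in> first_arrival G i"
    using ex_first_arrival[OF assms] by auto
  then have "0 < \<omega> (i, 0)"
    using r by (simp add: regular_arrivals_def)
  then show ?thesis
    by (rule queue_before_first_arrival[OF r i])
qed

lemma hitting_time_first_step:
  assumes r: "regular_arrivals G \<omega>" and fin: "finite (nodes G)"
    and i: "i \<in> nodes G" and f: "\<omega> \<in> first_arrival G i" and z: "z \<noteq> a"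
  shows "hitting_time (queue G \<Phi> z \<omega>) a =
    ennreal (\<omega> (i, 0)) + hitting_time (queue G \<Phi> (arrive \<Phi> i z) (shift_arrivals G i \<omega>)) a"
proof -
  let ?m = "\<omega> (i, 0)"
  have m: "0 \<le> ?m"
    using r i by (simp add: regular_arrivals_def less_imp_le)
  have "{t. 0 \<le> t \<and> queue G \<Phi> z \<omega> t = a} =
      (+) ?m ` {t. 0 \<le> t \<and> queue G \<Phi> (arrive \<Phi> i z) (shift_arrivals G i \<omega>) t = a}"
    (is "?A = _ ` ?B")
  proof (intro set_eqI iffI)
    fix t assume t: "t \<in> ?A"
    then have "?m \<le> t"
      using z queue_before_first_arrival[OF r i f, of t \<Phi> z] by (cases "t < ?m") auto
    then obtain s where "0 \<le> s" "t = ?m + s"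
      using that[of "t - ?m"] by simp
    then show "t \<in> (+) ?m ` ?B"
      using t by (auto simp: queue_after_first_arrival[OF r fin i f])
  qed (use m in \<open>auto simp: queue_after_first_arrival[OF r fin i f]\<close>)
  then show ?thesis
    using m by (simp only: hitting_time_def) (intro INF_ennreal_shift, auto)
qed

text \<open>Every arrival adds or removes an item. Hence the first arrival is the moment at which
  the initial state is left, as the departure clause of \<open>return_time\<close> demands.\<close>

lemma arrive_neq: "arrive \<Phi> i z \<noteq> z"
proof (cases "find (\<lambda>j. 0 < z j) (\<Phi> i)")
  case None
  then show ?thesis
    by (auto simp: arrive_def fun_eq_iff)
next
  case (Some j)
  then have "0 < z j"
    by (auto simp: find_Some_iff)
  with Some show ?thesis
    by (auto simp: arrive_def fun_eq_iff intro!: exI[of _ j])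
qed

lemma return_time_first_step:
  assumes r: "regular_arrivals G \<omega>" and fin: "finite (nodes G)"
    and i: "i \<in> nodes G" and f: "\<omega> \<in> first_arrival G i"
  shows "return_time (queue G \<Phi> z \<omega>) =
    ennreal (\<omega> (i, 0)) + hitting_time (queue G \<Phi> (arrive \<Phi> i z) (shift_arrivals G i \<omega>)) z"
proof -
  let ?m = "\<omega> (i, 0)" and ?X = "queue G \<Phi> z \<omega>"
  have m: "0 < ?m"
    using r i by (simp add: regular_arrivals_def)
  have X0: "?X 0 = z"
    by (rule queue_before_first_arrival[OF r i f m])
  have Xm: "?X ?m = arrive \<Phi> i z"
    using queue_after_first_arrival[OF r fin i f, of 0 \<Phi> z]
      queue_0[OF regular_arrivals_shift[OF r i f] fin, of \<Phi>] i by auto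
  have "{t. 0 \<le> t \<and> ?X t = ?X 0 \<and> (\<exists>s. 0 \<le> s \<and> s < t \<and> ?X s \<noteq> ?X 0)} =
      (+) ?m ` {t. 0 \<le> t \<and> queue G \<Phi> (arrive \<Phi> i z) (shift_arrivals G i \<omega>) t = z}"
    (is "?A = _ ` ?B")
  proof (intro set_eqI iffI)
    fix t assume t: "t \<in> ?A"
    then obtain s where "s < t" "?X s \<noteq> z"
      by (auto simp: X0)
    then have "?m \<le> t"
      using queue_before_first_arrival[OF r i f, of s \<Phi> z] by (cases "t < ?m") auto
    then obtain s where "0 \<le> s" "t = ?m + s"
      using that[of "t - ?m"] by simp
    then show "t \<in> (+) ?m ` ?B"
      using t X0 by (auto simp: queue_after_first_arrival[OF r fin i f])
  next
    fix t assume "t \<in> (+) ?m ` ?B"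
    then obtain s where s: "t = ?m + s" "0 \<le> s" "?X t = z"
      by (auto simp: queue_after_first_arrival[OF r fin i f])
    \<comment> \<open>A return cannot coincide with the first arrival, so the first arrival itself
      witnesses an earlier departure.\<close>
    moreover have "?m < t"
      using s Xm arrive_neq[of \<Phi> i z] by (cases "s = 0") auto
    ultimately show "t \<in> ?A"
      using m X0 Xm arrive_neq[of \<Phi> i z] by (auto intro!: exI[of _ ?m])
  qed
  then show ?thesis
    using m by (simp only: return_time_def hitting_time_def) (intro INF_ennreal_shift, auto)
qed

section \<open>Mean hitting times of finitely branching chains\<close>

text \<open>A Markov chain driven by independent choices of a map \<open>step i\<close> with
  probability \<open>p i\<close>. Means over n steps become iterated finite sums, without a space of
  trajectories.\<close>

locale finite_step_chain =
  fixes N :: "'i set" and p :: "'i \<Rightarrow> real" and step :: "'i \<Rightarrow> 's \<Rightarrow> 's" and S :: "'s set"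
  assumes finite_N: "finite N"
    and p_pos: "i \<in> N \<Longrightarrow> 0 < p i"
    and sum_p: "(\<Sum>i\<in>N. p i) = 1"
    and step_S: "i \<in> N \<Longrightarrow> x \<in> S \<Longrightarrow> step i x \<in> S"
begin

definition mean_step :: "('s \<Rightarrow> real) \<Rightarrow> 's \<Rightarrow> real" where
  "mean_step f x = (\<Sum>i\<in>N. p i * f (step i x))"

text \<open>\<open>survival a n x\<close> is the probability that the chain started at \<open>x\<close> avoids \<open>a\<close> during the
  steps \<open>0, \<dots>, n\<close>; \<open>mean_hit a n x\<close> is the mean of the hitting time of \<open>a\<close>, truncated at \<open>n\<close>.\<close>

primrec survival :: "'s \<Rightarrow> nat \<Rightarrow> 's \<Rightarrow> real" where
  "survival a 0 x = (if x = a then 0 else 1)"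
| "survival a (Suc n) x = (if x = a then 0 else mean_step (survival a n) x)"

primrec mean_hit :: "'s \<Rightarrow> nat \<Rightarrow> 's \<Rightarrow> real" where
  "mean_hit a 0 x = 0"
| "mean_hit a (Suc n) x = (if x = a then 0 else 1 + mean_step (mean_hit a n) x)"

lemma mean_step_mono:
  assumes "x \<in> S" "\<And>y. y \<in> S \<Longrightarrow> f y \<le> g y"
  shows "mean_step f x \<le> mean_step g x"
  unfolding mean_step_def using assms
  by (intro sum_mono mult_left_mono) (auto simp: step_S p_pos less_imp_le)

lemma mean_step_add: "mean_step (\<lambda>x. f x + g x) x = mean_step f x + mean_step g x"
  by (simp add: mean_step_def distrib_left sum.distrib)

lemma mean_step_cmult: "mean_step (\<lambda>x. c * f x) x = c * mean_step f x"
  by (simp add: mean_step_def sum_distrib_left mult.left_commute)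

lemma mean_step_const: "mean_step (\<lambda>x. c) x = c"
  by (simp add: mean_step_def sum_p flip: sum_distrib_right)

lemma mean_step_nonneg: "(\<And>y. 0 \<le> f y) \<Longrightarrow> 0 \<le> mean_step f x"
  unfolding mean_step_def by (intro sum_nonneg) (simp add: p_pos less_imp_le)

lemma survival_nonneg: "0 \<le> survival a n x"
  by (induction n arbitrary: x) (auto intro: mean_step_nonneg)

lemma mean_hit_nonneg: "0 \<le> mean_hit a n x"
  by (induction n arbitrary: x) (auto intro!: mean_step_nonneg add_nonneg_nonneg)

text \<open>For the hitting time T, min(T, n + 1) exceeds min(T, n) by one exactly when T > n. So
  the truncated means are partial sums of survival probabilities.\<close>

lemma mean_hit_Suc: "mean_hit a (Suc n) x = mean_hit a n x + survival a n x"
proof (induction n arbitrary: x)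
  case (Suc n)
  then have "mean_step (mean_hit a (Suc n)) x = mean_step (\<lambda>x. mean_hit a n x + survival a n x) x"
    by presburger
  then show ?case
    unfolding mean_hit.simps(2)[of a "Suc n"] by (simp add: mean_step_add)
qed (simp add: mean_step_def)

lemma mean_hit_eq_sum: "mean_hit a n x = (\<Sum>k<n. survival a k x)"
  by (induction n) (simp_all only: mean_hit.simps(1) lessThan_0 sum.empty mean_hit_Suc sum.lessThan_Suc)

lemma mean_hit_mono: "m \<le> n \<Longrightarrow> mean_hit a m x \<le> mean_hit a n x"
  unfolding mean_hit_eq_sum by (intro sum_mono2) (auto simp: survival_nonneg)

text \<open>Before the hitting time of \<open>a\<close> the mean of \<open>V\<close> does not decrease, while \<open>V\<close> vanishes at \<open>a\<close>
  and is at most \<open>V x + c n\<close> after \<open>n\<close> steps.\<close>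

lemma survival_ge:
  assumes V: "\<forall>x\<in>S. 0 \<le> V x" "V a = 0"
    and drift: "\<forall>x\<in>S. x \<noteq> a \<longrightarrow> V x \<le> mean_step V x"
    and lip: "\<forall>i\<in>N. \<forall>x\<in>S. V (step i x) \<le> V x + c"
    and x: "x \<in> S"
  shows "V x \<le> (V x + c * real n) * survival a n x"
  using x
proof (induction n arbitrary: x)
  case 0
  then show ?case
    using V by auto
next
  case (Suc n)
  show ?case
  proof (cases "x = a")
    case False
    have "V x \<le> mean_step V x"
      using drift Suc.prems False by simp
    also have "\<dots> \<le> (\<Sum>i\<in>N. p i * ((V x + c * real (Suc n)) * survival a n (step i x)))"
      unfolding mean_step_def
    proof (intro sum_mono mult_left_mono)
      fix i assume i: "i \<in> N"
      have "V (step i x) \<le> (V (step i x) + c * real n) * survival a n (step i x)"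
        using Suc i by (simp add: step_S)
      also have "\<dots> \<le> (V x + c * real (Suc n)) * survival a n (step i x)"
        using lip i Suc.prems by (intro mult_right_mono survival_nonneg) (simp add: algebra_simps)
      finally show "V (step i x) \<le> (V x + c * real (Suc n)) * survival a n (step i x)" .
    qed (simp add: p_pos less_imp_le)
    also have "\<dots> = (V x + c * real (Suc n)) * survival a (Suc n) x"
      using False by (simp add: mean_step_def sum_distrib_left mult.left_commute)
    finally show ?thesis .
  qed (use V in simp)
qed

lemma mean_hit_unbounded:
  assumes V: "\<forall>x\<in>S. 0 \<le> V x" "V a = 0"
    and drift: "\<forall>x\<in>S. x \<noteq> a \<longrightarrow> V x \<le> mean_step V x"
    and lip: "\<forall>i\<in>N. \<forall>x\<in>S. V (step i x) \<le> V x + c"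
    and x: "x \<in> S" "0 < V x"
  shows "\<exists>n. B < mean_hit a n x"
proof (rule ccontr)
  assume "\<nexists>n. B < mean_hit a n x"
  then have bound: "(\<Sum>k<n. survival a k x) \<le> B" for n
    by (simp add: not_less mean_hit_eq_sum)
  \<comment> \<open>With this C, V x + c n is at most C (n + 1), so the lower bounds on survival are
    a multiple of the harmonic series.\<close>
  define C where "C = max (V x) c"
  have C: "0 < C" "V x \<le> C" "c \<le> C"
    using x by (auto simp: C_def)
  have "V x / C * (1 / real (Suc n)) \<le> survival a n x" for n
  proof -
    have "V x \<le> (V x + c * real n) * survival a n x"
      using survival_ge[OF V drift lip x(1)] .
    also have "\<dots> \<le> (C * real (Suc n)) * survival a n x"
      using C mult_right_mono[of c C "real n"]
      by (intro mult_right_mono survival_nonneg) (simp add: algebra_simps)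
    finally show ?thesis
      using C by (simp add: divide_le_eq mult.commute)
  qed
  moreover have "summable (\<lambda>k. survival a k x)"
    by (rule summableI_nonneg_bounded[OF survival_nonneg bound])
  ultimately have "summable (\<lambda>n. V x / C * (1 / real (Suc n)))"
    using x C by (intro summable_comparison_test[of "\<lambda>n. V x / C * (1 / real (Suc n))" "\<lambda>k. survival a k x"])
      (auto simp del: of_nat_Suc intro!: exI[of _ 0])
  then have "summable (\<lambda>n. 1 / real (Suc n))"
    using x C summable_cmult_iff[of "V x / C" "\<lambda>n. 1 / real (Suc n)"] by simp
  then have "summable (\<lambda>n. inverse (real n))"
    using summable_Suc_iff[of "\<lambda>n. inverse (real n)"] by (simp add: inverse_eq_divide)
  then show False
    using not_summable_harmonic[where 'a = real] by simp
qed

text \<open>The truncation is the same on both sides and x = a is no exception, so the bound can be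
  iterated along a path that may pass through \<open>a\<close>.\<close>

lemma mean_hit_le_one_step: "mean_hit a n x \<le> 1 + mean_step (mean_hit a n) x"
proof (cases n)
  case 0
  then show ?thesis
    by (simp add: mean_step_def)
next
  case (Suc m)
  have "mean_step (mean_hit a m) x \<le> mean_step (mean_hit a n) x"
    unfolding mean_step_def Suc
    by (intro sum_mono mult_left_mono mean_hit_mono) (auto simp: p_pos less_imp_le)
  then show ?thesis
    using mean_step_nonneg[of "mean_hit a n" x, OF mean_hit_nonneg] by (cases "x = a") (simp_all add: Suc)
qed

text \<open>Foster's criterion, combined with the strong Markov property at the hitting time of \<open>b\<close>.\<close>

lemma mean_hit_le_via:
  assumes V: "\<forall>x\<in>S. 0 \<le> V x" and "0 < e"
    and drift: "\<forall>x\<in>S. x \<noteq> b \<longrightarrow> mean_step V x \<le> V x - e"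
    and x: "x \<in> S"
  shows "mean_hit a n x \<le> V x / e + mean_hit a n b"
  using x
proof (induction n arbitrary: x)
  case 0
  then show ?case
    using V \<open>0 < e\<close> by simp
next
  case (Suc n)
  consider "x = a" | "x = b" | "x \<noteq> a" "x \<noteq> b"
    by blast
  then show ?case
  proof cases
    case 1
    then show ?thesis
      using V Suc.prems \<open>0 < e\<close> mean_hit_nonneg[of a "Suc n" b] by auto
  next
    case 2
    then show ?thesis
      using V Suc.prems \<open>0 < e\<close> by simp
  next
    case 3
    have "mean_hit a (Suc n) x \<le> 1 + mean_step (\<lambda>y. 1 / e * V y + mean_hit a n b) x"
      using 3 Suc by (auto intro!: mean_step_mono)
    also have "\<dots> = 1 + mean_step V x / e + mean_hit a n b"
      by (simp only: mean_step_add mean_step_cmult mean_step_const) simp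
    also have "mean_step V x / e \<le> (V x - e) / e"
      using drift 3 Suc.prems \<open>0 < e\<close> by (intro divide_right_mono) auto
    also have "\<dots> = V x / e - 1"
      using \<open>0 < e\<close> by (simp add: diff_divide_distrib)
    also have "mean_hit a n b \<le> mean_hit a (Suc n) b"
      by (rule mean_hit_mono) simp
    finally show ?thesis
      by simp
  qed
qed

text \<open>Excursions from b: the given path leads to \<open>a\<close> with some probability q > 0,
  and after a deviation from it the chain hits \<open>a\<close> or is back at b within a mean time
  bounded through V / e. So the truncated mean h at b satisfies h \<le> C + (1 - q) h with C and q
  independent of the truncation.\<close>

lemma mean_hit_bounded_from_base:
  assumes V: "\<forall>x\<in>S. 0 \<le> V x" and "0 < e"
    and drift: "\<forall>x\<in>S. x \<noteq> b \<longrightarrow> mean_step V x \<le> V x - e"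
    and path: "set is \<subseteq> N" "fold step is b = a" "b \<in> S"
  shows "\<exists>C. \<forall>n. mean_hit a n b \<le> C"
proof -
  \<comment> \<open>The induction is on the rest of the path, started at x. The witness for q is the
    product of the probabilities along it; C collects the steps and the mean costs of getting back
    to b.\<close>
  have "\<exists>C q. 0 < q \<and> (\<forall>n. mean_hit a n x \<le> C + (1 - q) * mean_hit a n b)"
    if "set is \<subseteq> N" "fold step is x = a" "x \<in> S" for x
    using that
  proof (induction "is" arbitrary: x)
    case Nil
    then have "mean_hit a n x = 0" for n
      by (cases n) auto
    then show ?case
      by (intro exI[of _ 0] exI[of _ 1]) simp
  next
    case (Cons i "is")
    have "set is \<subseteq> N" "fold step is (step i x) = a" "step i x \<in> S"
      using Cons.prems step_S by auto
    from Cons.IH[OF this] obtain C q where q: "0 < q"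
      and IH: "\<And>n. mean_hit a n (step i x) \<le> C + (1 - q) * mean_hit a n b"
      by blast
    define r where "r = (\<Sum>j\<in>N - {i}. p j * (V (step j x) / e))"
    have i: "i \<in> N"
      using Cons by simp
    have p1: "(\<Sum>j\<in>N - {i}. p j) = 1 - p i"
      using sum_p sum.remove[OF finite_N i, of p] by simp
    have "mean_hit a n x \<le> (1 + p i * C + r) + (1 - p i * q) * mean_hit a n b" for n
    proof -
      have "mean_hit a n x \<le> 1 + mean_step (mean_hit a n) x"
        by (rule mean_hit_le_one_step)
      also have "mean_step (mean_hit a n) x =
          p i * mean_hit a n (step i x) + (\<Sum>j\<in>N - {i}. p j * mean_hit a n (step j x))"
        unfolding mean_step_def by (rule sum.remove[OF finite_N i])
      also have "(\<Sum>j\<in>N - {i}. p j * mean_hit a n (step j x)) \<le>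
          (\<Sum>j\<in>N - {i}. p j * (V (step j x) / e + mean_hit a n b))"
        using Cons.prems by (intro sum_mono mult_left_mono mean_hit_le_via[OF V \<open>0 < e\<close> drift])
          (auto simp: step_S p_pos less_imp_le)
      also have "\<dots> = r + (1 - p i) * mean_hit a n b"
        unfolding r_def p1[symmetric] by (simp add: distrib_left sum.distrib sum_distrib_right)
      also have "p i * mean_hit a n (step i x) \<le> p i * (C + (1 - q) * mean_hit a n b)"
        using IH p_pos[OF i] by (intro mult_left_mono) auto
      finally show ?thesis
        by (simp add: algebra_simps)
    qed
    then show ?case
      using q p_pos[OF i] by (intro exI[of _ "1 + p i * C + r"] exI[of _ "p i * q"]) auto
  qed
  from this[OF path] obtain C q where "0 < q" "\<And>n. mean_hit a n b \<le> C + (1 - q) * mean_hit a n b"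
    by blast
  \<comment> \<open>The truncated mean is a real number, so (1 - q) h may be moved to the left; this
    is what the truncation is for.\<close>
  then have "mean_hit a n b \<le> C / q" for n
    by (simp add: pos_le_divide_eq algebra_simps)
  then show ?thesis
    by blast
qed

lemma mean_hit_bounded:
  assumes V: "\<forall>x\<in>S. 0 \<le> V x" and "0 < e"
    and drift: "\<forall>x\<in>S. x \<noteq> b \<longrightarrow> mean_step V x \<le> V x - e"
    and path: "set is \<subseteq> N" "fold step is b = a" "b \<in> S" and x: "x \<in> S"
  shows "\<exists>C. \<forall>n. mean_hit a n x \<le> C"
proof -
  obtain C where "\<And>n. mean_hit a n b \<le> C"
    using mean_hit_bounded_from_base[OF V \<open>0 < e\<close> drift path] by blast
  then have "mean_hit a n x \<le> V x / e + C" for n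
    using mean_hit_le_via[OF V \<open>0 < e\<close> drift x, of a n] add_left_mono order_trans by blast
  then show ?thesis
    by blast
qed

end

section \<open>Restarting the arrivals at the first arrival\<close>

locale matching_queue =
  fixes G :: "'v ugraph" and rate :: "'v \<Rightarrow> real" and \<Phi> :: "'v \<Rightarrow> 'v list"
  assumes simple: "simple_graph G" and nodes_nonempty: "nodes G \<noteq> {}"
    and rate_pos: "i \<in> nodes G \<Longrightarrow> 0 < rate i"
    and policy: "priority_policy G \<Phi>"
begin

abbreviation total_rate :: real where
  "total_rate \<equiv> \<Sum>i\<in>nodes G. rate i"

abbreviation P :: "('v \<times> nat \<Rightarrow> real) measure" where
  "P \<equiv> interarrivals G rate"

text \<open>The value \<open>1\<close> outside of \<open>nodes G\<close> makes every factor a probability space.\<close>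

definition coord :: "'v \<times> nat \<Rightarrow> real measure" where
  "coord k = exp_measure (if fst k \<in> nodes G then rate (fst k) else 1)"

lemma finite_nodes: "finite (nodes G)"
  using simple by (simp add: simple_graph_def)

lemma total_rate_pos: "0 < total_rate"
  using finite_nodes nodes_nonempty rate_pos by (rule sum_pos)

lemma sets_coord [measurable_cong, simp]: "sets (coord k) = sets borel"
  by (simp add: coord_def)

lemma space_coord [simp]: "space (coord k) = UNIV"
  by (simp add: coord_def)

lemma coord_eq: "i \<in> nodes G \<Longrightarrow> coord (i, n) = exp_measure (rate i)"
  by (simp add: coord_def)

lemma prob_space_coord: "prob_space (coord k)"
  unfolding coord_def by (rule prob_space_exp_measure) (simp add: rate_pos)

lemma interarrivals_eq: "P = PiM (nodes G \<times> UNIV) coord"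
  unfolding interarrivals_def by (rule PiM_cong) (auto simp: coord_def exp_measure_def)

lemma prob_space_interarrivals: "prob_space P"
  unfolding interarrivals_eq by (intro prob_space_PiM prob_space_coord)

lemma measurable_interarrival [measurable]:
  assumes "i \<in> nodes G"
  shows "(\<lambda>\<omega>. \<omega> (i, n)) \<in> borel_measurable P"
proof -
  have "(\<lambda>\<omega>. \<omega> (i, n)) \<in> measurable P (coord (i, n))"
    unfolding interarrivals_eq using assms by (intro measurable_component_singleton) auto
  then show ?thesis
    by (simp only: measurable_cong_sets[OF refl sets_coord])
qed

lemma measurable_shift_arrivals:
  assumes i: "i \<in> nodes G"
  shows "shift_arrivals G i \<in> measurable P P"
proof -
  have "shift_arrivals G i \<in> measurable P (PiM (nodes G \<times> UNIV) coord)"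
    unfolding shift_arrivals_def
    by (rule measurable_restrict) (use i in \<open>auto simp: split_beta\<close>)
  then show ?thesis
    by (simp add: interarrivals_eq)
qed

lemma measurable_first_arrival [measurable]:
  assumes i: "i \<in> nodes G"
  shows "(\<lambda>\<omega>. indicator (first_arrival G i) \<omega> :: ennreal) \<in> borel_measurable P"
proof -
  have "Measurable.pred P (\<lambda>\<omega>. \<forall>j\<in>nodes G. j \<noteq> i \<longrightarrow> \<omega> (i, 0) < \<omega> (j, 0))"
    using finite_nodes i by (intro pred_intros_finite) (auto simp: pred_def intro: borel_measurable_less)
  then show ?thesis
    unfolding first_arrival_def indicator_def by simp
qed

text \<open>Condition on t = \<open>\<omega> (i, 0)\<close>. By memorylessness each competing class
  contributes the tail exp(- t \<open>rate j\<close>) and the probability of its box; integrating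
  the product of the tails over t gives \<open>rate i / total_rate\<close>. J contains all first
  coordinates, so every competitor has a factor that carries its constraint.\<close>

lemma first_arrival_shift_box:
  assumes i: "i \<in> nodes G" and J: "finite J" "J \<subseteq> nodes G \<times> UNIV" "nodes G \<times> {0} \<subseteq> J"
    and B: "\<And>k. k \<in> J \<Longrightarrow> B k \<in> sets borel"
  shows "(\<integral>\<^sup>+\<omega>. indicator (first_arrival G i) \<omega> * (\<Prod>k\<in>J. indicator (B k) (shift_arrivals G i \<omega> k)) \<partial>P)
    = ennreal (rate i / total_rate) * (\<Prod>k\<in>J. emeasure (coord k) (B k))"
proof -
  \<comment> \<open>Coordinate k of the shifted point is computed from coordinate
    \<open>\<sigma> k\<close> of the original one, and \<open>\<tau>\<close> is a left inverse.
    \<open>(i, 0)\<close> is not in the range of \<open>\<sigma>\<close>, which leaves it free for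
    conditioning.\<close>
  define \<sigma> where "\<sigma> k = (if fst k = i then (i, Suc (snd k)) else k)" for k :: "'v \<times> nat"
  define \<tau> where "\<tau> k = (if fst k = i then (i, snd k - 1) else k)" for k :: "'v \<times> nat"
  define late where "late k \<longleftrightarrow> snd k = (0::nat) \<and> fst k \<noteq> i" for k
  define f :: "'v \<times> nat \<Rightarrow> real \<Rightarrow> real \<Rightarrow> ennreal" where
    "f k t x = (if late k then indicator {t<..} x * indicator (B k) (x - t) else indicator (B k) x)" for k t x
  have \<tau>\<sigma> [simp]: "\<tau> (\<sigma> k) = k" for k
    by (cases k) (auto simp: \<sigma>_def \<tau>_def)
  then have inj: "inj_on \<sigma> J"
    by (metis inj_onI)
  have fst_\<sigma> [simp]: "fst (\<sigma> k) = fst k" for k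
    by (simp add: \<sigma>_def)
  have pointwise: "indicator (first_arrival G i) \<omega> * (\<Prod>k\<in>J. indicator (B k) (shift_arrivals G i \<omega> k))
      = (\<Prod>k\<in>\<sigma> ` J. f (\<tau> k) (\<omega> (i, 0)) (\<omega> k))" for \<omega>
  proof -
    have "indicator (first_arrival G i) \<omega> * (\<Prod>k\<in>J. indicator (B k) (shift_arrivals G i \<omega> k))
      = (\<Prod>k\<in>J. f k (\<omega> (i, 0)) (\<omega> (\<sigma> k)))"
    proof (cases "\<omega> \<in> first_arrival G i")
      case True
      then show ?thesis
        using J by (auto simp: f_def late_def \<sigma>_def shift_arrivals_def first_arrival_def indicator_def
            intro!: prod.cong)
    next
      case False
      \<comment> \<open>One competitor that does not arrive later annihilates the whole
        product.\<close>
      then obtain j where j: "j \<in> nodes G" "j \<noteq> i" "\<not> \<omega> (i, 0) < \<omega> (j, 0)"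
        by (auto simp: first_arrival_def)
      then have "f (j, 0) (\<omega> (i, 0)) (\<omega> (\<sigma> (j, 0))) = 0" "(j, 0) \<in> J"
        using J by (auto simp: f_def late_def \<sigma>_def)
      then have "(\<Prod>k\<in>J. f k (\<omega> (i, 0)) (\<omega> (\<sigma> k))) = 0"
        using J(1) by (auto intro!: prod_zero)
      with False show ?thesis
        by simp
    qed
    then show ?thesis
      by (simp add: prod.reindex[OF inj])
  qed
  have f_meas [measurable]: "(\<lambda>(t, x). f (\<tau> l) t x) \<in> borel_measurable (coord (i, 0) \<Otimes>\<^sub>M coord l)"
    if "l \<in> \<sigma> ` J" for l
  proof -
    have [measurable]: "B (\<tau> l) \<in> sets borel"
      using that B by auto
    have eq: "(\<lambda>(t, x). f (\<tau> l) t x) = (\<lambda>y. if late (\<tau> l)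
        then (if fst y < snd y \<and> snd y - fst y \<in> B (\<tau> l) then 1 else 0) else indicator (B (\<tau> l)) (snd y))"
      by (auto simp: f_def fun_eq_iff indicator_def)
    show ?thesis
      unfolding eq by measurable
  qed
  define r where "r = (\<Sum>j\<in>nodes G - {i}. rate j)"
  have r: "0 \<le> r" "rate i + r = total_rate"
    using finite_nodes i rate_pos sum.remove[of "nodes G" i rate]
    by (auto simp: r_def less_imp_le intro!: sum_nonneg)
  have inner: "(\<Prod>k\<in>J. \<integral>\<^sup>+x. f k t x \<partial>coord (\<sigma> k)) =
      (\<Prod>k\<in>J. emeasure (coord k) (B k)) * ennreal (exp (- t * r))" if t: "0 < t" for t
  proof -
    have "(\<integral>\<^sup>+x. f k t x \<partial>coord (\<sigma> k)) =
        (if late k then ennreal (exp (- t * rate (fst k))) else 1) * emeasure (coord k) (B k)"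
      if k: "k \<in> J" for k
    proof -
      have rk: "fst k \<in> nodes G" "coord (\<sigma> k) = exp_measure (rate (fst k))" "coord k = exp_measure (rate (fst k))"
        using k J by (auto simp: coord_def)
      have [measurable]: "B k \<in> sets borel"
        using B k by simp
      show ?thesis
        unfolding rk(2,3) f_def using t rate_pos[OF rk(1)]
        by (simp add: exp_measure_memoryless nn_integral_indicator)
    qed
    then have "(\<Prod>k\<in>J. \<integral>\<^sup>+x. f k t x \<partial>coord (\<sigma> k)) =
        (\<Prod>k\<in>J. if late k then ennreal (exp (- t * rate (fst k))) else 1) *
        (\<Prod>k\<in>J. emeasure (coord k) (B k))"
      by (simp add: prod.distrib)
    also have "(\<Prod>k\<in>J. if late k then ennreal (exp (- t * rate (fst k))) else 1) =
        (\<Prod>k\<in>(\<lambda>j. (j, 0 :: nat)) ` (nodes G - {i}). ennreal (exp (- t * rate (fst k))))"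
      using J by (intro prod.mono_neutral_cong_right) (auto simp: late_def image_iff)
    also have "\<dots> = (\<Prod>j\<in>nodes G - {i}. ennreal (exp (- t * rate j)))"
      by (subst prod.reindex) (auto simp: inj_on_def)
    also have "\<dots> = ennreal (exp (- t * r))"
      unfolding r_def sum_distrib_left using finite_nodes
      by (subst exp_sum) (auto simp: prod_ennreal)
    finally show ?thesis
      by (simp add: mult.commute)
  qed
  have "(\<integral>\<^sup>+\<omega>. indicator (first_arrival G i) \<omega> * (\<Prod>k\<in>J. indicator (B k) (shift_arrivals G i \<omega> k)) \<partial>P)
      = (\<integral>\<^sup>+t. (\<Prod>l\<in>\<sigma> ` J. \<integral>\<^sup>+x. f (\<tau> l) t x \<partial>coord l) \<partial>coord (i, 0))"
    unfolding pointwise interarrivals_eq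
    using J i by (intro nn_integral_PiM_prod prob_space_coord f_meas) (auto simp: \<sigma>_def)
  also have "\<dots> = (\<integral>\<^sup>+t. (\<Prod>k\<in>J. \<integral>\<^sup>+x. f k t x \<partial>coord (\<sigma> k)) \<partial>coord (i, 0))"
    by (simp add: prod.reindex[OF inj])
  also have "\<dots> = (\<integral>\<^sup>+t. (\<Prod>k\<in>J. emeasure (coord k) (B k)) * ennreal (exp (- t * r)) \<partial>exp_measure (rate i))"
    unfolding coord_eq[OF i]
  proof (rule nn_integral_cong_AE)
    show "AE t in exp_measure (rate i). (\<Prod>k\<in>J. \<integral>\<^sup>+x. f k t x \<partial>coord (\<sigma> k)) =
        (\<Prod>k\<in>J. emeasure (coord k) (B k)) * ennreal (exp (- t * r))"
      using AE_exp_measure_pos by eventually_elim (rule inner)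
  qed
  also have "\<dots> = (\<Prod>k\<in>J. emeasure (coord k) (B k)) * (\<integral>\<^sup>+t. ennreal (exp (- t * r)) \<partial>exp_measure (rate i))"
  proof (rule nn_integral_cmult)
    note [measurable del] = measurable_interarrival
    show "(\<lambda>t. ennreal (exp (- t * r))) \<in> borel_measurable (exp_measure (rate i))"
      by measurable
  qed
  also have "\<dots> = ennreal (rate i / total_rate) * (\<Prod>k\<in>J. emeasure (coord k) (B k))"
    by (simp only: nn_integral_exp_exp_measure[OF rate_pos[OF i] r(1)] r(2)) (rule mult.commute)
  finally show ?thesis .
qed

text \<open>The class of the first arrival is independent of the arrivals after it, and these are
  distributed as the original ones.\<close>

lemma nn_integral_first_arrival_shift:
  assumes i: "i \<in> nodes G" and g [measurable]: "g \<in> borel_measurable P"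
  shows "(\<integral>\<^sup>+\<omega>. indicator (first_arrival G i) \<omega> * g (shift_arrivals G i \<omega>) \<partial>P)
    = ennreal (rate i / total_rate) * (\<integral>\<^sup>+\<omega>. g \<omega> \<partial>P)"
proof -
  note [measurable] = measurable_shift_arrivals[OF i] measurable_first_arrival[OF i]
  \<comment> \<open>\<open>?D\<close> is the law of the shifted arrivals restricted to the event
    that class i comes first, \<open>?Q\<close> is P scaled by the claimed probability of that
    event. Two finite measures on the product that agree on cylinders are equal.\<close>
  let ?D = "distr (density P (indicator (first_arrival G i))) P (shift_arrivals G i)"
  let ?Q = "density P (\<lambda>_. ennreal (rate i / total_rate))"
  have shift_density: "shift_arrivals G i \<in> measurable (density P (indicator (first_arrival G i))) P"
    by simp
  have "?Q = ?D"
  proof (rule measure_eqI_PiM_infinite[where I = "nodes G \<times> UNIV" and M = coord])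
    show "sets ?Q = sets (PiM (nodes G \<times> UNIV) coord)" "sets ?D = sets (PiM (nodes G \<times> UNIV) coord)"
      by (simp_all add: interarrivals_eq)
  next
    interpret prob_space P
      by (rule prob_space_interarrivals)
    show "finite_measure ?Q"
      by (rule finite_measureI) (simp add: emeasure_density emeasure_space_1)
  next
    fix A J assume J: "finite J" "J \<subseteq> nodes G \<times> UNIV" and A: "\<And>k. k \<in> J \<Longrightarrow> A k \<in> sets (coord k)"
    interpret product_prob_space coord "nodes G \<times> UNIV"
      by (intro product_prob_space.intro product_prob_space_axioms.intro product_sigma_finite.intro
        prob_space_coord prob_space_imp_sigma_finite)
    \<comment> \<open>The cylinder is rewritten over a larger base, with the whole line as new
      factors, to include all first coordinates as \<open>first_arrival_shift_box\<close>
      demands.\<close>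
    define L where "L = J \<union> nodes G \<times> {0}"
    define B where "B k = (if k \<in> J then A k else UNIV)" for k
    let ?X = "prod_emb (nodes G \<times> UNIV) coord J (Pi\<^sub>E J A)"
    have L: "finite L" "L \<subseteq> nodes G \<times> UNIV" "nodes G \<times> {0} \<subseteq> L"
      using J finite_nodes by (auto simp: L_def)
    have B: "B k \<in> sets borel" for k
      using A by (auto simp: B_def)
    have X: "?X = prod_emb (nodes G \<times> UNIV) coord L (Pi\<^sub>E L B)"
    proof -
      have "(\<forall>k\<in>J. \<omega> k \<in> A k) \<longleftrightarrow> (\<forall>k\<in>L. \<omega> k \<in> B k)" for \<omega>
        unfolding L_def B_def by (metis UNIV_I UnI1)
      then show ?thesis
        by (auto simp: prod_emb_def PiE_iff)
    qed
    have emeasure_X: "emeasure P ?X = (\<Prod>k\<in>L. emeasure (coord k) (B k))"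
      unfolding X interarrivals_eq using L B by (subst emeasure_PiM_emb) auto
    have [measurable]: "?X \<in> sets P"
      unfolding X interarrivals_eq using L B by (intro sets_PiM_I) auto
    have ind: "indicator ?X \<omega> = (\<Prod>k\<in>L. indicator (B k) (\<omega> k) :: ennreal)" if \<omega>: "\<omega> \<in> space P" for \<omega>
    proof (cases "\<omega> \<in> ?X")
      case True
      then show ?thesis
        unfolding X by (auto simp: prod_emb_def PiE_iff intro!: prod.neutral)
    next
      case False
      then obtain k where "k \<in> L" "\<omega> k \<notin> B k"
        using \<omega> unfolding X by (auto simp: prod_emb_def PiE_iff interarrivals_eq space_PiM)
      then have "(\<Prod>k\<in>L. indicator (B k) (\<omega> k) :: ennreal) = 0"
        using L(1) by (intro prod_zero bexI[of _ k]) (auto simp: indicator_def)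
      with False show ?thesis
        by simp
    qed
    have "emeasure ?D ?X = (\<integral>\<^sup>+\<omega>. indicator ?X \<omega> \<partial>?D)"
      by simp
    also have "\<dots> = (\<integral>\<^sup>+\<omega>. indicator ?X (shift_arrivals G i \<omega>) \<partial>density P (indicator (first_arrival G i)))"
      by (rule nn_integral_distr[OF shift_density]) simp
    also have "\<dots> = (\<integral>\<^sup>+\<omega>. indicator (first_arrival G i) \<omega> * indicator ?X (shift_arrivals G i \<omega>) \<partial>P)"
      by (rule nn_integral_density) measurable
    also have "\<dots> = (\<integral>\<^sup>+\<omega>. indicator (first_arrival G i) \<omega> * (\<Prod>k\<in>L. indicator (B k) (shift_arrivals G i \<omega> k)) \<partial>P)"
      by (intro nn_integral_cong) (simp add: ind measurable_space[OF measurable_shift_arrivals[OF i]])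
    also have "\<dots> = ennreal (rate i / total_rate) * emeasure P ?X"
      unfolding emeasure_X by (rule first_arrival_shift_box[OF i L B])
    also have "\<dots> = emeasure ?Q ?X"
      by (simp add: emeasure_density nn_integral_cmult_indicator)
    finally show "emeasure ?Q ?X = emeasure ?D ?X" ..
  qed
  then have "(\<integral>\<^sup>+\<omega>. g \<omega> \<partial>?Q) = (\<integral>\<^sup>+\<omega>. g \<omega> \<partial>?D)"
    by simp
  also have "\<dots> = (\<integral>\<^sup>+\<omega>. g (shift_arrivals G i \<omega>) \<partial>density P (indicator (first_arrival G i)))"
    by (rule nn_integral_distr[OF shift_density]) simp
  also have "\<dots> = (\<integral>\<^sup>+\<omega>. indicator (first_arrival G i) \<omega> * g (shift_arrivals G i \<omega>) \<partial>P)"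
    by (rule nn_integral_density) measurable
  finally show ?thesis
    by (simp add: nn_integral_density nn_integral_cmult)
qed

section \<open>Regularity of almost every sample point\<close>

lemma AE_interarrivals_pos:
  assumes "i \<in> nodes G"
  shows "AE \<omega> in P. 0 < \<omega> (i, n)"
  unfolding interarrivals_eq
proof (rule AE_PiM_component[OF prob_space_coord])
  show "AE x in coord (i, n). 0 < x"
    unfolding coord_eq[OF assms] by (rule AE_exp_measure_pos)
qed (use assms in auto)

lemma arrival_time_split_first: "arrival_time \<omega> i n = \<omega> (i, 0) + (\<Sum>k\<in>{1..n}. \<omega> (i, k))"
  by (simp add: arrival_time_def sum.atLeast_Suc_atMost flip: atLeast0AtMost)

text \<open>With all other coordinates fixed, a tie forces \<open>\<omega> (i, 0)\<close> to equal
  the single value \<open>gap\<close>, which an exponential variable takes with probability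
  zero.\<close>

lemma AE_no_tie:
  assumes ij: "i \<in> nodes G" "j \<in> nodes G" "i \<noteq> j"
  shows "AE \<omega> in P. arrival_time \<omega> i m \<noteq> arrival_time \<omega> j n"
proof -
  define L where "L = {i} \<times> {1..m} \<union> {j} \<times> {..n}"
  define gap where "gap \<omega> = (\<Sum>k\<le>n. \<omega> (j, k)) - (\<Sum>k\<in>{1..m}. \<omega> (i, k))" for \<omega> :: "'v \<times> nat \<Rightarrow> real"
  define F :: "real \<Rightarrow> ('v \<times> nat \<Rightarrow> real) \<Rightarrow> ennreal" where "F t \<omega> = indicator {0} (t - gap \<omega>)" for t \<omega>
  have L: "finite L" "L \<subseteq> nodes G \<times> UNIV" "(i, 0) \<in> nodes G \<times> UNIV" "(i, 0) \<notin> L"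
    using ij by (auto simp: L_def)
  have comp: "(\<lambda>\<omega>. \<omega> k) \<in> borel_measurable (PiM L coord)" if "k \<in> L" for k
    using measurable_component_singleton[OF that, of coord]
    by (simp only: measurable_cong_sets[OF refl sets_coord])
  have [measurable]: "gap \<in> borel_measurable (PiM L coord)"
    unfolding gap_def by (intro borel_measurable_diff borel_measurable_sum comp) (auto simp: L_def)
  have [measurable]: "(\<lambda>(t, \<omega>). F t \<omega>) \<in> borel_measurable (coord (i, 0) \<Otimes>\<^sub>M PiM L coord)"
    unfolding F_def by measurable
  have F_eq: "F (\<omega> (i, 0)) (restrict \<omega> L) = indicator {0} (arrival_time \<omega> i m - arrival_time \<omega> j n)" for \<omega>
  proof -
    have gap: "gap (restrict \<omega> L) = gap \<omega>"
      by (simp add: gap_def L_def)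
    show ?thesis
      unfolding F_def gap unfolding gap_def arrival_time_split_first[of _ i] arrival_time_def[of _ j]
      by (simp add: algebra_simps)
  qed
  have [measurable]: "(\<lambda>\<omega>. arrival_time \<omega> l k) \<in> borel_measurable P" if "l \<in> nodes G" for l k
    unfolding arrival_time_def using that by (intro borel_measurable_sum measurable_interarrival)
  note [measurable] = ij(1,2)
  have F0: "(\<integral>\<^sup>+t. F t \<omega> \<partial>coord (i, 0)) = 0" for \<omega>
  proof -
    have "AE t in coord (i, 0). F t \<omega> = 0"
      unfolding coord_eq[OF ij(1)] using AE_exp_measure_neq[of "gap \<omega>" "rate i"]
      by eventually_elim (simp add: F_def)
    then have "(\<integral>\<^sup>+t. F t \<omega> \<partial>coord (i, 0)) = (\<integral>\<^sup>+t. 0 \<partial>coord (i, 0))"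
      by (rule nn_integral_cong_AE)
    then show ?thesis
      by simp
  qed
  have "(\<integral>\<^sup>+\<omega>. indicator {0} (arrival_time \<omega> i m - arrival_time \<omega> j n) \<partial>P) =
      (\<integral>\<^sup>+\<omega>. \<integral>\<^sup>+t. F t \<omega> \<partial>coord (i, 0) \<partial>PiM L coord)"
    unfolding F_eq[symmetric] interarrivals_eq
    by (intro nn_integral_PiM_split_coordinate(2) prob_space_coord L) measurable
  also have "\<dots> = 0"
    by (simp add: F0)
  finally have "(\<integral>\<^sup>+\<omega>. indicator {0} (arrival_time \<omega> i m - arrival_time \<omega> j n) \<partial>P) = 0" .
  then have "AE \<omega> in P. indicator {0} (arrival_time \<omega> i m - arrival_time \<omega> j n) = (0::ennreal)"
    by (subst (asm) nn_integral_0_iff_AE) (use ij in measurable)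
  then show ?thesis
    by eventually_elim (auto simp: indicator_def split: if_splits)
qed

text \<open>By independence, the mean of \<open>exp (- arrival_time \<omega> i n)\<close> tends to zero.\<close>

lemma AE_arrivals_unbounded:
  assumes i: "i \<in> nodes G"
  shows "AE \<omega> in P. \<forall>t. \<exists>n. t < arrival_time \<omega> i n"
proof -
  define q where "q = rate i / (rate i + 1)"
  have q: "0 \<le> q" "q < 1"
    using rate_pos[OF i] by (auto simp: q_def)
  have [measurable]: "(\<lambda>\<omega>. arrival_time \<omega> i n) \<in> borel_measurable P" for n
    unfolding arrival_time_def using i by (intro borel_measurable_sum measurable_interarrival)
  have laplace: "(\<integral>\<^sup>+\<omega>. ennreal (exp (- arrival_time \<omega> i n)) \<partial>P) = ennreal (q ^ Suc n)" for n
  proof -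
    have "ennreal (exp (- arrival_time \<omega> i n)) = (\<Prod>k\<in>{i} \<times> {..n}. ennreal (exp (- \<omega> k * 1)))" for \<omega>
    proof -
      have "{i} \<times> {..n} = Pair i ` {..n}"
        by auto
      then show ?thesis
        by (simp add: prod.reindex inj_on_def arrival_time_def exp_sum prod_ennreal flip: sum_negf)
    qed
    \<comment> \<open>\<open>nn_integral_PiM_prod\<close> conditions on a coordinate outside the
      product; \<open>(i, Suc n)\<close> is a dummy on which no factor depends.\<close>
    then have "(\<integral>\<^sup>+\<omega>. ennreal (exp (- arrival_time \<omega> i n)) \<partial>P) =
        (\<integral>\<^sup>+\<omega>. (\<Prod>k\<in>{i} \<times> {..n}. (\<lambda>_ _ x. ennreal (exp (- x * 1))) k (\<omega> (i, Suc n)) (\<omega> k)) \<partial>P)"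
      by simp
    also have "\<dots> = (\<integral>\<^sup>+t. (\<Prod>k\<in>{i} \<times> {..n}. \<integral>\<^sup>+x. ennreal (exp (- x * 1)) \<partial>coord k) \<partial>coord (i, Suc n))"
      unfolding interarrivals_eq
      by (intro nn_integral_PiM_prod prob_space_coord) (use i in auto)
    also have "\<dots> = (\<integral>\<^sup>+t. (\<Prod>k\<in>{i} \<times> {..n}. ennreal q) \<partial>coord (i, Suc n))"
      using i nn_integral_exp_exp_measure[OF rate_pos[OF i], of 1] unfolding q_def
      by (intro nn_integral_cong prod.cong refl) (auto simp: coord_eq)
    also have "\<dots> = ennreal (q ^ Suc n)"
      using prob_space.emeasure_space_1[OF prob_space_coord, of "(i, Suc n)"] q
      by (simp add: card_cartesian_product ennreal_power ennreal_mult)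
    finally show ?thesis .
  qed
  have "(\<integral>\<^sup>+\<omega>. (INF n. ennreal (exp (- arrival_time \<omega> i n))) \<partial>P) \<le> ennreal (q ^ Suc n)" for n
    unfolding laplace[symmetric] by (intro nn_integral_mono INF_lower) simp
  moreover have "(\<lambda>n. ennreal (q ^ Suc n)) \<longlonglongrightarrow> ennreal 0"
    using q LIMSEQ_Suc[OF LIMSEQ_realpow_zero[OF q]] by (intro tendsto_ennrealI) auto
  ultimately have "(\<integral>\<^sup>+\<omega>. (INF n. ennreal (exp (- arrival_time \<omega> i n))) \<partial>P) \<le> ennreal 0"
    by (intro LIMSEQ_le_const) auto
  then have "AE \<omega> in P. (INF n. ennreal (exp (- arrival_time \<omega> i n))) = 0"
    by (subst nn_integral_0_iff_AE[symmetric]) auto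
  then show ?thesis
  proof eventually_elim
    case (elim \<omega>)
    show ?case
    proof (rule ccontr)
      assume "\<not> ?case"
      then obtain t where "arrival_time \<omega> i n \<le> t" for n
        by (auto simp: not_less)
      then have "ennreal (exp (- t)) \<le> (INF n. ennreal (exp (- arrival_time \<omega> i n)))"
        by (intro INF_greatest) simp
      then show False
        using elim by simp
    qed
  qed
qed

lemma AE_regular_arrivals: "AE \<omega> in P. regular_arrivals G \<omega>"
proof -
  have "AE \<omega> in P. \<forall>i\<in>nodes G. \<forall>n. 0 < \<omega> (i, n)"
    using finite_nodes by (auto intro!: AE_finite_allI AE_interarrivals_pos simp: AE_all_countable)
  moreover have "AE \<omega> in P. \<forall>i\<in>nodes G. \<forall>j\<in>nodes G. \<forall>m n. i \<noteq> j \<longrightarrow> arrival_time \<omega> i m \<noteq> arrival_time \<omega> j n"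
    using finite_nodes by (intro AE_finite_allI) (auto simp: AE_all_countable intro: AE_no_tie)
  moreover have "AE \<omega> in P. \<forall>i\<in>nodes G. \<forall>t. \<exists>n. t < arrival_time \<omega> i n"
    using finite_nodes by (intro AE_finite_allI AE_arrivals_unbounded) auto
  ultimately show ?thesis
    unfolding regular_arrivals_def by eventually_elim blast
qed

end

section \<open>Mean return times of matching queues\<close>

lemma queue_states_mono:
  assumes "z \<in> queue_states G" "\<And>i. z' i \<le> z i"
  shows "z' \<in> queue_states G"
proof -
  have "z' i = 0" if "z i = 0" for i
    using assms(2)[of i] that by simp
  then show ?thesis
    using assms(1) by (simp add: queue_states_def) metis
qed

lemma (in matching_queue) arrive_queue_states:
  assumes i: "i \<in> nodes G" and z: "z \<in> queue_states G"
  shows "arrive \<Phi> i z \<in> queue_states G"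
proof (cases "find (\<lambda>j. 0 < z j) (\<Phi> i)")
  case None
  then have "z j = 0" if "{i, j} \<in> edges G" for j
    using that i policy by (auto simp: find_None_iff priority_policy_def neighbors_def)
  moreover have "{i, i} \<notin> edges G"
    using simple by (auto simp: simple_graph_def)
  ultimately show ?thesis
    using None i z by (auto simp: arrive_def queue_states_def insert_commute)
next
  case (Some j)
  then show ?thesis
    using z by (auto simp: arrive_def intro: queue_states_mono)
qed

text \<open>This is the jump chain: by \<open>nn_integral_first_arrival_shift\<close> the next
  arrival is of class i with probability \<open>rate i / total_rate\<close>.\<close>

sublocale matching_queue \<subseteq> finite_step_chain "nodes G" "\<lambda>i. rate i / total_rate" "arrive \<Phi>" "queue_states G"
proof
  show "(\<Sum>i\<in>nodes G. rate i / total_rate) = 1"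
    using total_rate_pos unfolding sum_divide_distrib[symmetric] by simp
qed (simp_all add: finite_nodes rate_pos total_rate_pos arrive_queue_states)

context matching_queue
begin

text \<open>\<open>hit_cost c a n z \<omega>\<close> is the time until the queue process hits \<open>a\<close>, but at most the
  \<open>n\<close>-th arrival time, with an extra cost \<open>c\<close> for each arrival.\<close>

primrec hit_cost :: "ennreal \<Rightarrow> ('v \<Rightarrow> nat) \<Rightarrow> nat \<Rightarrow> ('v \<Rightarrow> nat) \<Rightarrow> ('v \<times> nat \<Rightarrow> real) \<Rightarrow> ennreal" where
  "hit_cost c a 0 z \<omega> = 0"
| "hit_cost c a (Suc n) z \<omega> = (if z = a then 0 else \<Sum>i\<in>nodes G. indicator (first_arrival G i) \<omega> *
    (ennreal (\<omega> (i, 0)) + c + hit_cost c a n (arrive \<Phi> i z) (shift_arrivals G i \<omega>)))"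

lemma hit_cost_0: "hit_cost c a 0 z = (\<lambda>\<omega>. 0)"
  by (rule ext) simp

text \<open>Almost surely exactly one indicator is one, so this is the mean time to the first
  arrival plus c, that is 1 / \<open>total_rate\<close> + c. Below it enters only as a positive
  finite factor.\<close>

definition mean_cost :: "ennreal \<Rightarrow> ennreal" where
  "mean_cost c = (\<integral>\<^sup>+\<omega>. (\<Sum>i\<in>nodes G. indicator (first_arrival G i) \<omega> * (ennreal (\<omega> (i, 0)) + c)) \<partial>P)"

lemma measurable_hit_cost [measurable]: "hit_cost c a n z \<in> borel_measurable P"
proof (induction n arbitrary: z)
  case 0
  show ?case
    unfolding hit_cost_0 by simp
next
  case (Suc n)
  have [measurable]: "(\<lambda>\<omega>. hit_cost c a n z (shift_arrivals G i \<omega>)) \<in> borel_measurable P" if "i \<in> nodes G" for i z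
    using measurable_compose[OF measurable_shift_arrivals[OF that] Suc] .
  have "hit_cost c a (Suc n) z = (\<lambda>\<omega>. if z = a then 0 else \<Sum>i\<in>nodes G. indicator (first_arrival G i) \<omega> *
      (ennreal (\<omega> (i, 0)) + c + hit_cost c a n (arrive \<Phi> i z) (shift_arrivals G i \<omega>)))"
    by (rule ext) simp
  then show ?case
    by simp
qed

text \<open>The restart property, summed over the class of the first arrival. The continuations
  \<open>g i\<close> are general because both truncated costs and their suprema are
  inserted.\<close>

lemma nn_integral_first_step:
  assumes [measurable]: "\<And>i. i \<in> nodes G \<Longrightarrow> g i \<in> borel_measurable P"
  shows "(\<integral>\<^sup>+\<omega>. (\<Sum>i\<in>nodes G. indicator (first_arrival G i) \<omega> *
      (ennreal (\<omega> (i, 0)) + c + g i (shift_arrivals G i \<omega>))) \<partial>P) =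
    mean_cost c + (\<Sum>i\<in>nodes G. ennreal (rate i / total_rate) * (\<integral>\<^sup>+\<omega>. g i \<omega> \<partial>P))"
proof -
  have [measurable]: "(\<lambda>\<omega>. g i (shift_arrivals G i \<omega>)) \<in> borel_measurable P" if "i \<in> nodes G" for i
    using measurable_compose[OF measurable_shift_arrivals[OF that] assms[OF that]] .
  have "(\<integral>\<^sup>+\<omega>. (\<Sum>i\<in>nodes G. indicator (first_arrival G i) \<omega> *
      (ennreal (\<omega> (i, 0)) + c + g i (shift_arrivals G i \<omega>))) \<partial>P) =
    (\<integral>\<^sup>+\<omega>. (\<Sum>i\<in>nodes G. indicator (first_arrival G i) \<omega> * (ennreal (\<omega> (i, 0)) + c)) +
      (\<Sum>i\<in>nodes G. indicator (first_arrival G i) \<omega> * g i (shift_arrivals G i \<omega>)) \<partial>P)"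
    by (simp add: distrib_left sum.distrib)
  also have "\<dots> = mean_cost c +
      (\<Sum>i\<in>nodes G. \<integral>\<^sup>+\<omega>. indicator (first_arrival G i) \<omega> * g i (shift_arrivals G i \<omega>) \<partial>P)"
    unfolding mean_cost_def by (subst nn_integral_add) (simp_all add: nn_integral_sum)
  finally show ?thesis
    by (simp add: nn_integral_first_arrival_shift)
qed

text \<open>A form of Wald's identity: mean cost per arrival times mean number of arrivals.\<close>

lemma nn_integral_hit_cost:
  "(\<integral>\<^sup>+\<omega>. hit_cost c a n z \<omega> \<partial>P) = mean_cost c * ennreal (mean_hit a n z)"
proof (induction n arbitrary: z)
  case (Suc n)
  show ?case
  proof (cases "z = a")
    case False
    then have "(\<integral>\<^sup>+\<omega>. hit_cost c a (Suc n) z \<omega> \<partial>P) = mean_cost c +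
        (\<Sum>i\<in>nodes G. ennreal (rate i / total_rate) * (mean_cost c * ennreal (mean_hit a n (arrive \<Phi> i z))))"
      using nn_integral_first_step[where g = "\<lambda>i. hit_cost c a n (arrive \<Phi> i z)", OF measurable_hit_cost]
      by (simp add: Suc)
    also have "\<dots> = mean_cost c * (1 + (\<Sum>i\<in>nodes G. ennreal (rate i / total_rate) * ennreal (mean_hit a n (arrive \<Phi> i z))))"
      by (simp only: distrib_left sum_distrib_left mult_1_right mult.left_commute)
    also have "(\<Sum>i\<in>nodes G. ennreal (rate i / total_rate) * ennreal (mean_hit a n (arrive \<Phi> i z))) =
        (\<Sum>i\<in>nodes G. ennreal (rate i / total_rate * mean_hit a n (arrive \<Phi> i z)))"
      by (intro sum.cong refl ennreal_mult[symmetric] less_imp_le p_pos mean_hit_nonneg)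
    also have "\<dots> = ennreal (mean_step (mean_hit a n) z)"
      unfolding mean_step_def
      by (intro sum_ennreal mult_nonneg_nonneg less_imp_le p_pos mean_hit_nonneg)
    also have "mean_cost c * (1 + ennreal (mean_step (mean_hit a n) z)) = mean_cost c * ennreal (mean_hit a (Suc n) z)"
      using False mean_step_nonneg[of "mean_hit a n" z, OF mean_hit_nonneg] by (simp add: ennreal_plus)
    finally show ?thesis .
  qed simp
next
  case 0
  show ?case
    unfolding hit_cost_0 by simp
qed

section \<open>Costs compared with hitting times, path by path\<close>

lemma sum_first_arrival:
  fixes X :: "'v \<Rightarrow> ennreal"
  assumes i: "i \<in> nodes G" "\<omega> \<in> first_arrival G i"
  shows "(\<Sum>j\<in>nodes G. indicator (first_arrival G j) \<omega> * X j) = X i"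
proof -
  have "(\<Sum>j\<in>nodes G. indicator (first_arrival G j) \<omega> * X j) = (\<Sum>j\<in>nodes G. if j = i then X j else 0)"
  proof (rule sum.cong)
    fix j assume "j \<in> nodes G"
    then have "\<omega> \<in> first_arrival G j \<longleftrightarrow> j = i"
      using i first_arrival_unique by metis
    then show "indicator (first_arrival G j) \<omega> * X j = (if j = i then X j else 0)"
      by (simp add: indicator_def)
  qed simp
  then show ?thesis
    using finite_nodes i by simp
qed

lemma mean_cost_pos: "0 < mean_cost c"
proof (rule ccontr)
  assume "\<not> 0 < mean_cost c"
  then have "AE \<omega> in P. (\<Sum>i\<in>nodes G. indicator (first_arrival G i) \<omega> * (ennreal (\<omega> (i, 0)) + c)) = 0"
    unfolding mean_cost_def by (subst nn_integral_0_iff_AE[symmetric]) auto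
  with AE_regular_arrivals have "AE \<omega> in P. False"
  proof eventually_elim
    case (elim \<omega>)
    obtain i where "i \<in> nodes G" "\<omega> \<in> first_arrival G i"
      using ex_first_arrival[OF elim(1) finite_nodes nodes_nonempty] by auto
    then show ?case
      using elim regular_arrivals_pos[OF elim(1), of i 0] by (simp add: sum_first_arrival)
  qed
  then show False
    using prob_space.AE_False[OF prob_space_interarrivals] by simp
qed

lemma mean_cost_finite:
  assumes "c < \<infinity>"
  shows "mean_cost c < \<infinity>"
proof -
  have fin: "(\<integral>\<^sup>+\<omega>. ennreal (\<omega> (i, 0)) \<partial>P) < \<infinity>" if i: "i \<in> nodes G" for i
  proof -
    have m: "(\<lambda>\<omega>. \<omega> (i, 0)) \<in> measurable P (coord (i, 0))"
      unfolding interarrivals_eq using i by (intro measurable_component_singleton) auto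
    have "distr P (coord (i, 0)) (\<lambda>\<omega>. \<omega> (i, 0)) = coord (i, 0)"
      unfolding interarrivals_eq using i by (intro distr_PiM_component prob_space_coord) auto
    then have "(\<integral>\<^sup>+\<omega>. ennreal (\<omega> (i, 0)) \<partial>P) = (\<integral>\<^sup>+t. ennreal t \<partial>coord (i, 0))"
      using nn_integral_distr[OF m, of ennreal]
      by (simp add: measurable_cong_sets[OF sets_coord refl])
    also have "\<dots> < \<infinity>"
      unfolding coord_eq[OF i] using rate_pos[OF i] by (rule nn_integral_exp_measure_id)
    finally show ?thesis .
  qed
  have "mean_cost c \<le> (\<integral>\<^sup>+\<omega>. (\<Sum>i\<in>nodes G. ennreal (\<omega> (i, 0)) + c) \<partial>P)"
    unfolding mean_cost_def by (intro nn_integral_mono sum_mono) (auto simp: indicator_def)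
  also have "\<dots> = (\<Sum>i\<in>nodes G. (\<integral>\<^sup>+\<omega>. ennreal (\<omega> (i, 0)) \<partial>P) + c)"
    using prob_space.emeasure_space_1[OF prob_space_interarrivals]
    by (simp add: nn_integral_sum nn_integral_add)
  also have "\<dots> < \<infinity>"
    using fin assms finite_nodes by simp
  finally show ?thesis .
qed

lemma hit_cost_le_hitting_time:
  assumes "regular_arrivals G \<omega>"
  shows "hit_cost 0 a n z \<omega> \<le> hitting_time (queue G \<Phi> z \<omega>) a"
  using assms
proof (induction n arbitrary: z \<omega>)
  case (Suc n)
  obtain i where i: "i \<in> nodes G" "\<omega> \<in> first_arrival G i"
    using ex_first_arrival[OF Suc.prems finite_nodes nodes_nonempty] by auto
  show ?case
  proof (cases "z = a")
    case False
    then show ?thesis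
      using Suc.IH[OF regular_arrivals_shift[OF Suc.prems i]]
      by (simp add: sum_first_arrival[OF i] hitting_time_first_step[OF Suc.prems finite_nodes i False])
  qed simp
qed simp

text \<open>The charge of one per arrival takes care of paths that avoid \<open>a\<close>: after n
  arrivals they have paid at least n, so the supremum of the costs dominates even an infinite
  hitting time.\<close>

lemma hitting_time_le_hit_cost:
  assumes "regular_arrivals G \<omega>"
  shows "hitting_time (queue G \<Phi> z \<omega>) a \<le> hit_cost 1 a n z \<omega> \<or> of_nat n \<le> hit_cost 1 a n z \<omega>"
  using assms
proof (induction n arbitrary: z \<omega>)
  case (Suc n)
  obtain i where i: "i \<in> nodes G" "\<omega> \<in> first_arrival G i"
    using ex_first_arrival[OF Suc.prems finite_nodes nodes_nonempty] by auto
  let ?z = "arrive \<Phi> i z" and ?\<omega> = "shift_arrivals G i \<omega>"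
  show ?case
  proof (cases "z = a")
    case True
    then show ?thesis
      using hitting_time_self[of "queue G \<Phi> z \<omega>" a] queue_0[OF Suc.prems finite_nodes nodes_nonempty] by simp
  next
    case False
    have cost: "hit_cost 1 a (Suc n) z \<omega> = ennreal (\<omega> (i, 0)) + 1 + hit_cost 1 a n ?z ?\<omega>"
      using False by (simp add: sum_first_arrival[OF i])
    have hit: "hitting_time (queue G \<Phi> z \<omega>) a = ennreal (\<omega> (i, 0)) + hitting_time (queue G \<Phi> ?z ?\<omega>) a"
      by (rule hitting_time_first_step[OF Suc.prems finite_nodes i False])
    from Suc.IH[OF regular_arrivals_shift[OF Suc.prems i], of ?z] show ?thesis
    proof
      assume "hitting_time (queue G \<Phi> ?z ?\<omega>) a \<le> hit_cost 1 a n ?z ?\<omega>"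
      then have "ennreal (\<omega> (i, 0)) + 0 + hitting_time (queue G \<Phi> ?z ?\<omega>) a \<le> hit_cost 1 a (Suc n) z \<omega>"
        unfolding cost by (intro add_mono) auto
      then show ?thesis
        by (simp add: hit)
    next
      assume "of_nat n \<le> hit_cost 1 a n ?z ?\<omega>"
      then have "0 + 1 + of_nat n \<le> hit_cost 1 a (Suc n) z \<omega>"
        unfolding cost by (intro add_mono) auto
      then show ?thesis
        by simp
    qed
  qed
qed simp

lemma hitting_time_le_SUP:
  assumes "regular_arrivals G \<omega>"
  shows "hitting_time (queue G \<Phi> z \<omega>) a \<le> (SUP n. hit_cost 1 a n z \<omega>)"
proof (cases "\<exists>n. hitting_time (queue G \<Phi> z \<omega>) a \<le> hit_cost 1 a n z \<omega>")
  case True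
  then show ?thesis
    by (auto intro: SUP_upper2)
next
  case False
  then have "of_nat n \<le> hit_cost 1 a n z \<omega>" for n
    using hitting_time_le_hit_cost[OF assms] by blast
  then have "(SUP n. of_nat n :: ennreal) \<le> (SUP n. hit_cost 1 a n z \<omega>)"
    by (intro SUP_mono) blast
  then have top: "(SUP n. hit_cost 1 a n z \<omega>) = top"
    by (simp only: ennreal_SUP_of_nat_eq_top top_unique)
  show ?thesis
    unfolding top by (rule top_greatest)
qed

lemma incseq_hit_cost: "incseq (\<lambda>n. hit_cost c a n z)"
proof (rule incseq_SucI)
  fix n show "hit_cost c a n z \<le> hit_cost c a (Suc n) z"
  proof (induction n arbitrary: z)
    case (Suc n)
    then show ?case
      by (auto simp: le_fun_def simp del: hit_cost.simps(2) simp: hit_cost.simps(2)[of c a n] hit_cost.simps(2)[of c a "Suc n"]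
          intro!: sum_mono mult_left_mono add_left_mono)
  qed (simp add: le_fun_def)
qed

text \<open>The supremum of the charged costs gives a measurable majorant of the return time; by
  monotone convergence its mean inherits the uniform bound on the truncated means.\<close>

lemma mean_return_time_finite:
  assumes "\<And>i. i \<in> nodes G \<Longrightarrow> \<exists>C. \<forall>n. mean_hit z n (arrive \<Phi> i z) \<le> C"
  shows "(\<integral>\<^sup>+\<omega>. return_time (queue G \<Phi> z \<omega>) \<partial>P) < \<infinity>"
proof -
  let ?h = "\<lambda>i \<omega>. SUP n. hit_cost 1 z n (arrive \<Phi> i z) \<omega>"
  have fin: "(\<integral>\<^sup>+\<omega>. ?h i \<omega> \<partial>P) < \<infinity>" if i: "i \<in> nodes G" for i
  proof -
    obtain C where C: "\<And>n. mean_hit z n (arrive \<Phi> i z) \<le> C"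
      using assms[OF i] by blast
    have "(\<integral>\<^sup>+\<omega>. ?h i \<omega> \<partial>P) = (SUP n. mean_cost 1 * ennreal (mean_hit z n (arrive \<Phi> i z)))"
      by (subst nn_integral_monotone_convergence_SUP[OF incseq_hit_cost]) (simp_all add: nn_integral_hit_cost)
    also have "\<dots> \<le> mean_cost 1 * ennreal C"
      using C by (intro SUP_least mult_left_mono ennreal_leI) auto
    also have "\<dots> < \<infinity>"
      using mean_cost_finite[of 1] by (simp add: ennreal_mult_less_top)
    finally show ?thesis .
  qed
  have "(\<integral>\<^sup>+\<omega>. return_time (queue G \<Phi> z \<omega>) \<partial>P) \<le>
    (\<integral>\<^sup>+\<omega>. (\<Sum>i\<in>nodes G. indicator (first_arrival G i) \<omega> *
      (ennreal (\<omega> (i, 0)) + 0 + ?h i (shift_arrivals G i \<omega>))) \<partial>P)"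
  proof (rule nn_integral_mono_AE)
    show "AE \<omega> in P. return_time (queue G \<Phi> z \<omega>) \<le> (\<Sum>i\<in>nodes G. indicator (first_arrival G i) \<omega> *
      (ennreal (\<omega> (i, 0)) + 0 + ?h i (shift_arrivals G i \<omega>)))"
      using AE_regular_arrivals
    proof eventually_elim
      case (elim \<omega>)
      obtain i where i: "i \<in> nodes G" "\<omega> \<in> first_arrival G i"
        using ex_first_arrival[OF elim finite_nodes nodes_nonempty] by auto
      show ?case
        unfolding sum_first_arrival[OF i] return_time_first_step[OF elim finite_nodes i] add_0_right
        by (intro add_left_mono hitting_time_le_SUP regular_arrivals_shift elim i)
    qed
  qed
  also have "\<dots> = mean_cost 0 + (\<Sum>i\<in>nodes G. ennreal (rate i / total_rate) * (\<integral>\<^sup>+\<omega>. ?h i \<omega> \<partial>P))"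
    by (rule nn_integral_first_step) measurable
  also have "\<dots> < \<infinity>"
    using fin finite_nodes mean_cost_finite[of 0] by (auto simp: ennreal_mult_less_top)
  finally show ?thesis .
qed

text \<open>A measurable minorant: keep only the sample points whose first arrival is of class i,
  and count only the uncharged truncated cost after it.\<close>

lemma mean_return_time_infinite:
  assumes i: "i \<in> nodes G" and unbounded: "\<And>B. \<exists>n. B < mean_hit z n (arrive \<Phi> i z)"
  shows "(\<integral>\<^sup>+\<omega>. return_time (queue G \<Phi> z \<omega>) \<partial>P) = \<infinity>"
proof (rule ccontr)
  assume "\<not> ?thesis"
  then obtain R where R: "0 \<le> R" "(\<integral>\<^sup>+\<omega>. return_time (queue G \<Phi> z \<omega>) \<partial>P) = ennreal R"
    by (cases "\<integral>\<^sup>+\<omega>. return_time (queue G \<Phi> z \<omega>) \<partial>P") auto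
  obtain m where m: "0 < m" "mean_cost 0 = ennreal m"
    using mean_cost_pos[of 0] mean_cost_finite[of 0] by (cases "mean_cost 0") auto
  define q where "q = rate i / total_rate"
  have q: "0 < q"
    unfolding q_def by (rule p_pos[OF i])
  have "q * (m * mean_hit z n (arrive \<Phi> i z)) \<le> R" for n
  proof -
    have "ennreal (q * (m * mean_hit z n (arrive \<Phi> i z))) =
        ennreal q * (\<integral>\<^sup>+\<omega>. hit_cost 0 z n (arrive \<Phi> i z) \<omega> \<partial>P)"
      using q m by (simp add: nn_integral_hit_cost ennreal_mult mean_hit_nonneg)
    also have "\<dots> = (\<integral>\<^sup>+\<omega>. indicator (first_arrival G i) \<omega> *
        hit_cost 0 z n (arrive \<Phi> i z) (shift_arrivals G i \<omega>) \<partial>P)"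
      unfolding q_def by (intro nn_integral_first_arrival_shift[symmetric] i measurable_hit_cost)
    also have "\<dots> \<le> (\<integral>\<^sup>+\<omega>. return_time (queue G \<Phi> z \<omega>) \<partial>P)"
    proof (rule nn_integral_mono_AE)
      show "AE \<omega> in P. indicator (first_arrival G i) \<omega> *
          hit_cost 0 z n (arrive \<Phi> i z) (shift_arrivals G i \<omega>) \<le> return_time (queue G \<Phi> z \<omega>)"
        using AE_regular_arrivals
      proof eventually_elim
        case (elim \<omega>)
        show ?case
        proof (cases "\<omega> \<in> first_arrival G i")
          case True
          have "hit_cost 0 z n (arrive \<Phi> i z) (shift_arrivals G i \<omega>) \<le>
              hitting_time (queue G \<Phi> (arrive \<Phi> i z) (shift_arrivals G i \<omega>)) z"
            by (intro hit_cost_le_hitting_time regular_arrivals_shift elim i True)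
          then show ?thesis
            using True by (simp add: return_time_first_step[OF elim finite_nodes i True] add_increasing)
        qed simp
      qed
    qed
    also have "\<dots> = ennreal R"
      by (rule R)
    finally show ?thesis
      using R by (simp add: ennreal_le_iff)
  qed
  moreover obtain n where "R / (q * m) < mean_hit z n (arrive \<Phi> i z)"
    using unbounded by blast
  then have "R < mean_hit z n (arrive \<Phi> i z) * (q * m)"
    using q m by (subst (asm) pos_divide_less_eq) auto
  ultimately show False
    by (metis mult.assoc mult.commute not_less)
qed

text \<open>Let the items of z arrive one at a time. All intermediate states lie below z, so no
  neighbour of an arriving item is queued and nothing is matched. Such a path lets one drift
  condition, with the empty state as base, bound the return times to every z.\<close>

lemma ex_arrivals_from_empty:
  assumes "z \<in> queue_states G"
  shows "\<exists>is. set is \<subseteq> nodes G \<and> fold (arrive \<Phi>) is (\<lambda>_. 0) = z"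
  using assms
proof (induction "\<Sum>i\<in>nodes G. z i" arbitrary: z)
  case 0
  then have "z = (\<lambda>_. 0)"
    using finite_nodes by (auto simp: queue_states_def)
  then show ?case
    by (intro exI[of _ "[]"]) auto
next
  case (Suc n)
  then obtain i where i: "i \<in> nodes G" "0 < z i"
    by (metis gr0I sum.neutral nat.distinct(1))
  define z' where "z' = z(i := z i - 1)"
  have "(\<Sum>j\<in>nodes G. z j) = Suc (\<Sum>j\<in>nodes G. z' j)"
    using i finite_nodes by (simp add: z'_def sum.remove[of _ i])
  moreover have "z' \<in> queue_states G"
    using Suc.prems by (rule queue_states_mono) (simp add: z'_def)
  ultimately obtain "is" where "is": "set is \<subseteq> nodes G" "fold (arrive \<Phi>) is (\<lambda>_. 0) = z'"
    using Suc.hyps by (metis Suc_inject)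
  have "z' j = 0" if "j \<in> set (\<Phi> i)" for j
  proof -
    have "{i, j} \<in> edges G"
      using that i policy by (auto simp: priority_policy_def neighbors_def)
    then have "z i = 0 \<or> z j = 0"
      using Suc.prems by (auto simp: queue_states_def)
    then show ?thesis
      using i by (auto simp: z'_def)
  qed
  then have "find (\<lambda>j. 0 < z' j) (\<Phi> i) = None"
    by (auto simp: find_None_iff)
  then have "arrive \<Phi> i z' = z"
    using i by (auto simp: arrive_def z'_def fun_eq_iff)
  then show ?case
    using i "is" by (intro exI[of _ "is @ [i]"]) auto
qed

section \<open>Drift criteria for stability and instability\<close>

lemma empty_queue_state: "(\<lambda>_. 0) \<in> queue_states G"
  by (simp add: queue_states_def)

lemma stable_queueI:
  assumes "\<forall>z\<in>queue_states G. 0 \<le> V z" "0 < e"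
    and "\<forall>z\<in>queue_states G. z \<noteq> (\<lambda>_. 0) \<longrightarrow> mean_step V z \<le> V z - e"
  shows "stable_queue G rate \<Phi>"
  unfolding stable_queue_def
proof
  fix z assume z: "z \<in> queue_states G"
  obtain "is" where "is": "set is \<subseteq> nodes G" "fold (arrive \<Phi>) is (\<lambda>_. 0) = z"
    using ex_arrivals_from_empty[OF z] by blast
  show "(\<integral>\<^sup>+\<omega>. return_time (queue G \<Phi> z \<omega>) \<partial>P) < \<infinity>"
    using mean_hit_bounded[OF assms "is" empty_queue_state] z
    by (intro mean_return_time_finite) (auto intro: arrive_queue_states)
qed

lemma not_stable_queueI:
  assumes "\<forall>z\<in>queue_states G. 0 \<le> V z" "V (\<lambda>_. 0) = 0"
    and "\<forall>z\<in>queue_states G. z \<noteq> (\<lambda>_. 0) \<longrightarrow> V z \<le> mean_step V z"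
    and "\<forall>i\<in>nodes G. \<forall>z\<in>queue_states G. V (arrive \<Phi> i z) \<le> V z + c"
    and i: "i \<in> nodes G" "0 < V (arrive \<Phi> i (\<lambda>_. 0))"
  shows "\<not> stable_queue G rate \<Phi>"
proof -
  have "(\<integral>\<^sup>+\<omega>. return_time (queue G \<Phi> (\<lambda>_. 0) \<omega>) \<partial>P) = \<infinity>"
  proof (rule mean_return_time_infinite[OF i(1)])
    show "\<exists>n. B < mean_hit (\<lambda>_. 0) n (arrive \<Phi> i (\<lambda>_. 0))" for B
      by (rule mean_hit_unbounded[where V = V and c = c])
        (intro assms arrive_queue_states empty_queue_state)+
  qed
  then have "\<not> (\<integral>\<^sup>+\<omega>. return_time (queue G \<Phi> (\<lambda>_. 0) \<omega>) \<partial>P) < \<infinity>"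
    by simp
  then show ?thesis
    using empty_queue_state unfolding stable_queue_def by blast
qed

end

section \<open>The pendant graph\<close>

lemma nodes_pendant [simp]: "nodes pendant = {1, 2, 3, 4}"
  by (simp add: pendant_def)

lemma neighbors_pendant:
  "neighbors pendant 1 = {2, 3}" "neighbors pendant 2 = {1, 3}"
  "neighbors pendant 3 = {1, 2, 4}" "neighbors pendant 4 = {3}"
  by (auto simp: neighbors_def pendant_def doubleton_eq_iff)

lemma queue_states_pendant:
  assumes "z \<in> queue_states pendant"
  shows "z 1 = 0 \<or> z 2 = 0" "z 1 = 0 \<or> z 3 = 0" "z 2 = 0 \<or> z 3 = 0" "z 3 = 0 \<or> z 4 = 0"
    and "i \<notin> {1, 2, 3, 4} \<Longrightarrow> z i = 0"
proof -
  have disjoint: "z i = 0 \<or> z j = 0" if "{i, j} \<in> edges pendant" for i j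
    using assms that unfolding queue_states_def by simp
  have edges: "{1, 2} \<in> edges pendant" "{1, 3} \<in> edges pendant" "{2, 3} \<in> edges pendant" "{3, 4} \<in> edges pendant"
    unfolding pendant_def by simp_all
  show "z 1 = 0 \<or> z 2 = 0" "z 1 = 0 \<or> z 3 = 0" "z 2 = 0 \<or> z 3 = 0" "z 3 = 0 \<or> z 4 = 0"
    by (rule disjoint edges)+
  show "z i = 0" if "i \<notin> {1, 2, 3, 4}"
    using assms that unfolding queue_states_def by simp
qed

lemma find_eq_SomeI:
  assumes "k \<in> set xs" "Q k" "\<And>j. j \<in> set xs \<Longrightarrow> Q j \<Longrightarrow> j = k"
  shows "find Q xs = Some k"
  using assms
proof (induction xs)
  case (Cons x xs)
  show ?case
  proof (cases "Q x")
    case True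
    then have "x = k"
      by (intro Cons.prems(3)) simp
    with True show ?thesis
      by simp
  next
    case False
    then have "k \<in> set xs"
      using Cons.prems(1,2) by (cases "x = k") auto
    then have "find Q xs = Some k"
      using Cons.prems(2) by (rule Cons.IH) (rule Cons.prems(3), simp)
    with False show ?thesis
      by simp
  qed
qed simp

lemma arrive_queued: "(\<And>j. j \<in> set (\<Phi> i) \<Longrightarrow> z j = 0) \<Longrightarrow> arrive \<Phi> i z = z(i := z i + 1)"
proof -
  assume "\<And>j. j \<in> set (\<Phi> i) \<Longrightarrow> z j = 0"
  then have "find (\<lambda>j. 0 < z j) (\<Phi> i) = None"
    by (auto simp: find_None_iff)
  then show ?thesis
    by (simp add: arrive_def)
qed

lemma arrive_matched:
  assumes "k \<in> set (\<Phi> i)" "0 < z k" "\<And>j. j \<in> set (\<Phi> i) \<Longrightarrow> j \<noteq> k \<Longrightarrow> z j = 0"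
  shows "arrive \<Phi> i z = z(k := z k - 1)"
proof -
  have "find (\<lambda>j. 0 < z j) (\<Phi> i) = Some k"
  proof (rule find_eq_SomeI)
    fix j assume "j \<in> set (\<Phi> i)" "0 < z j"
    then show "j = k"
      using assms(3)[of j] by (cases "j = k") auto
  qed (use assms in auto)
  then show ?thesis
    by (simp add: arrive_def)
qed

text \<open>The non-empty independent sets are the singletons, {1, 4} and {2, 4}. The inequalities
  from {1} and {2} make the denominators in \<open>alpha\<close> positive.\<close>

lemma Ncond_pendant_iff:
  assumes "\<forall>i\<in>nodes pendant. 0 < rate i"
  shows "rate \<in> Ncond pendant \<longleftrightarrow> rate 1 < rate 2 + rate 3 \<and> rate 2 < rate 1 + rate 3 \<and>
    rate 3 < rate 1 + rate 2 + rate 4 \<and> rate 4 < rate 3 \<and>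
    rate 1 + rate 4 < rate 2 + rate 3 \<and> rate 2 + rate 4 < rate 1 + rate 3"
    (is "_ \<longleftrightarrow> ?R")
proof
  assume "rate \<in> Ncond pendant"
  then have N: "(\<Sum>i\<in>I. rate i) < (\<Sum>j\<in>(\<Union>i\<in>I. neighbors pendant i). rate j)"
    if "independent_set pendant I" "I \<noteq> {}" for I
    using that by (auto simp: Ncond_def)
  have "independent_set pendant {1}" "independent_set pendant {2}" "independent_set pendant {3}"
    "independent_set pendant {4}" "independent_set pendant {1, 4}" "independent_set pendant {2, 4}"
    by (auto simp: independent_set_def pendant_def doubleton_eq_iff)
  note N[OF this(1)] N[OF this(2)] N[OF this(3)] N[OF this(4)] N[OF this(5)] N[OF this(6)]
  moreover have "{2, 3} \<union> {3} = {2, 3 :: nat}" "{1, 3} \<union> {3} = {1, 3 :: nat}"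
    by auto
  ultimately show ?R
    by (simp del: One_nat_def add: neighbors_pendant insert_commute algebra_simps)
next
  assume R: ?R
  have "(\<Sum>i\<in>I. rate i) < (\<Sum>j\<in>(\<Union>i\<in>I. neighbors pendant i). rate j)"
    if "independent_set pendant I" "I \<noteq> {}" for I
  proof -
    have sub: "I \<subseteq> {1, 2, 3, 4}" and
      indep: "\<not> (1 \<in> I \<and> 2 \<in> I)" "\<not> (1 \<in> I \<and> 3 \<in> I)" "\<not> (2 \<in> I \<and> 3 \<in> I)" "\<not> (3 \<in> I \<and> 4 \<in> I)"
      using that unfolding independent_set_def by (auto simp: pendant_def)
    have "I \<in> {{1}, {2}, {3}, {4}, {1, 4}, {2, 4}}"
    proof -
      have "I \<in> Pow {1, 2, 3, 4}"
        using sub by simp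
      then show ?thesis
        using indep that(2) by (simp del: One_nat_def add: Pow_insert) (elim disjE; simp del: One_nat_def)
    qed
    moreover have "{2, 3} \<union> {3} = {2, 3 :: nat}" "{1, 3} \<union> {3} = {1, 3 :: nat}"
      by auto
    ultimately show ?thesis
      using R by (auto simp del: One_nat_def simp: neighbors_pendant insert_commute algebra_simps)
  qed
  then show "rate \<in> Ncond pendant"
    using assms by (auto simp: Ncond_def)
qed

section \<open>The constant alpha\<close>

lemma inverse_alpha:
  fixes rate :: "nat \<Rightarrow> real"
  shows "inverse (alpha rate) =
    1 + rate 1 / (rate 3 + rate 2 - rate 1) + rate 2 / (rate 3 + rate 1 - rate 2)"
  by (simp add: alpha_def)

lemma alpha_eq:
  fixes rate :: "nat \<Rightarrow> real"
  assumes pos: "0 < rate 1" "0 < rate 2" "0 < rate 3"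
    and "rate 1 < rate 2 + rate 3" "rate 2 < rate 1 + rate 3"
  shows "alpha rate = ((rate 3)\<^sup>2 - (rate 1 - rate 2)\<^sup>2) / (rate 3 * (rate 3 + rate 1 + rate 2))"
proof -
  define x y w where "x = rate 1" "y = rate 2" "w = rate 3"
  have d: "0 < w + y - x" "0 < w + x - y"
    using assms by (simp_all add: x_y_w_def)
  have "1 + x / (w + y - x) + y / (w + x - y) =
      ((w + y - x) * (w + x - y) + x * (w + x - y) + y * (w + y - x)) / ((w + y - x) * (w + x - y))"
    using d by (simp add: add_divide_distrib)
  \<comment> \<open>The product of the denominators is w^2 - (x - y)^2, and the other two terms add
    w (x + y) + (x - y)^2.\<close>
  also have "\<dots> = w * (w + x + y) / (w\<^sup>2 - (x - y)\<^sup>2)"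
    by (simp add: power2_eq_square algebra_simps)
  finally show ?thesis
    unfolding alpha_def x_y_w_def by simp
qed

section \<open>Drifts of weighted queue lengths\<close>

locale pendant_queue = matching_queue pendant rate \<Phi> for rate :: "nat \<Rightarrow> real" and \<Phi> +
  assumes priority: "\<Phi> 3 = [1, 2, 4] \<or> \<Phi> 3 = [2, 1, 4]"
begin

definition weighted_size :: "(nat \<Rightarrow> real) \<Rightarrow> (nat \<Rightarrow> nat) \<Rightarrow> real" where
  "weighted_size a z = (\<Sum>i\<in>{1, 2, 3, 4}. a i * real (z i))"

lemma rates_pos: "0 < rate 1" "0 < rate 2" "0 < rate 3" "0 < rate 4"
  using rate_pos by auto

lemma set_policy: "set (\<Phi> 1) = {2, 3}" "set (\<Phi> 2) = {1, 3}" "set (\<Phi> 3) = {1, 2, 4}" "set (\<Phi> 4) = {3}"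
  using policy by (auto simp: priority_policy_def neighbors_pendant simp del: One_nat_def)

lemma weighted_size_queued: "i \<in> {1, 2, 3, 4} \<Longrightarrow> weighted_size a (z(i := z i + 1)) = weighted_size a z + a i"
  by (auto simp: weighted_size_def algebra_simps)

lemma weighted_size_matched: "i \<in> {1, 2, 3, 4} \<Longrightarrow> 0 < z i \<Longrightarrow> weighted_size a (z(i := z i - 1)) = weighted_size a z - a i"
  by (auto simp: weighted_size_def algebra_simps of_nat_diff)

lemma weighted_size_arrive_le:
  assumes a: "\<And>i. 0 \<le> a i" and i: "i \<in> {1, 2, 3, 4}"
  shows "weighted_size a (arrive \<Phi> i z) \<le> weighted_size a z + a i"
proof (cases "find (\<lambda>j. 0 < z j) (\<Phi> i)")
  case None
  then show ?thesis
    unfolding arrive_def using weighted_size_queued[OF i] by simp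
next
  case (Some j)
  then have "j \<in> set (\<Phi> i)" "0 < z j"
    by (auto simp: find_Some_iff)
  moreover have "set (\<Phi> i) \<subseteq> {1, 2, 3, 4}"
    using i by (auto simp: set_policy simp del: One_nat_def)
  ultimately show ?thesis
    unfolding arrive_def using Some weighted_size_matched[of j z a] a[of i] a[of j] by auto
qed

text \<open>On non-empty states this is the generator of the continuous-time chain applied to
  \<open>weighted_size a\<close>, hence rates in place of probabilities. The last branch is meant
  for states with only class 4 queued; at the empty state it is a default value.\<close>

definition drift :: "(nat \<Rightarrow> real) \<Rightarrow> (nat \<Rightarrow> nat) \<Rightarrow> real" where
  "drift a z = (if 0 < z 3 then a 3 * (rate 3 - rate 1 - rate 2 - rate 4)
    else if 0 < z 1 then a 1 * (rate 1 - rate 2 - rate 3) + a 4 * rate 4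
    else if 0 < z 2 then a 2 * (rate 2 - rate 1 - rate 3) + a 4 * rate 4
    else a 1 * rate 1 + a 2 * rate 2 + a 4 * (rate 4 - rate 3))"

lemma sum_weighted_size_arrive:
  assumes z: "z \<in> queue_states pendant" "z \<noteq> (\<lambda>_. 0)"
  shows "(\<Sum>i\<in>{1, 2, 3, 4}. rate i * (weighted_size a (arrive \<Phi> i z) - weighted_size a z)) = drift a z"
proof -
  note q = queue_states_pendant[OF z(1)]
  define g where "g i = weighted_size a (arrive \<Phi> i z) - weighted_size a z" for i
  have sum: "(\<Sum>i\<in>{1, 2, 3, 4}. rate i * (weighted_size a (arrive \<Phi> i z) - weighted_size a z)) =
      rate 1 * g 1 + rate 2 * g 2 + rate 3 * g 3 + rate 4 * g 4"
    by (simp add: g_def)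
  consider "0 < z 3" "z 1 = 0" "z 2 = 0" "z 4 = 0" | "0 < z 1" "z 2 = 0" "z 3 = 0"
    | "0 < z 2" "z 1 = 0" "z 3 = 0" | "z 1 = 0" "z 2 = 0" "z 3 = 0"
    using q(1-4) by auto
  then show ?thesis
  proof cases
    case 1
    then have "arrive \<Phi> 1 z = z(3 := z 3 - 1)" "arrive \<Phi> 2 z = z(3 := z 3 - 1)"
      "arrive \<Phi> 3 z = z(3 := z 3 + 1)" "arrive \<Phi> 4 z = z(3 := z 3 - 1)"
      by (auto intro!: arrive_matched arrive_queued simp: set_policy simp del: One_nat_def)
    then have "g 1 = - a 3" "g 2 = - a 3" "g 3 = a 3" "g 4 = - a 3"
      unfolding g_def using 1 by (simp_all del: One_nat_def add: weighted_size_matched weighted_size_queued)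
    then show ?thesis
      unfolding sum using 1 by (simp del: One_nat_def add: drift_def algebra_simps)
  next
    case 2
    \<comment> \<open>Class 4 may be queued as well, so it is the priority at node 3 that decides
      this match; likewise in the next case.\<close>
    then have "arrive \<Phi> 3 z = z(1 := z 1 - 1)"
      using priority by (auto simp: arrive_def)
    moreover have "arrive \<Phi> 1 z = z(1 := z 1 + 1)" "arrive \<Phi> 2 z = z(1 := z 1 - 1)" "arrive \<Phi> 4 z = z(4 := z 4 + 1)"
      using 2 by (auto intro!: arrive_matched arrive_queued simp: set_policy simp del: One_nat_def)
    ultimately have "g 1 = a 1" "g 2 = - a 1" "g 3 = - a 1" "g 4 = a 4"
      unfolding g_def using 2 by (simp_all del: One_nat_def add: weighted_size_matched weighted_size_queued)
    then show ?thesis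
      unfolding sum using 2 by (simp del: One_nat_def add: drift_def algebra_simps)
  next
    case 3
    then have "arrive \<Phi> 3 z = z(2 := z 2 - 1)"
      using priority by (auto simp: arrive_def)
    moreover have "arrive \<Phi> 1 z = z(2 := z 2 - 1)" "arrive \<Phi> 2 z = z(2 := z 2 + 1)" "arrive \<Phi> 4 z = z(4 := z 4 + 1)"
      using 3 by (auto intro!: arrive_matched arrive_queued simp: set_policy simp del: One_nat_def)
    ultimately have "g 1 = - a 2" "g 2 = a 2" "g 3 = - a 2" "g 4 = a 4"
      unfolding g_def using 3 by (simp_all del: One_nat_def add: weighted_size_matched weighted_size_queued)
    then show ?thesis
      unfolding sum using 3 by (simp del: One_nat_def add: drift_def algebra_simps)
  next
    case 4
    \<comment> \<open>As z is not empty, class 4 must be queued, so an arriving class-3 item is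
      matched instead of joining the queue.\<close>
    have "0 < z 4"
    proof (rule ccontr)
      assume "\<not> 0 < z 4"
      then have "z i = 0" for i
        using 4 q(5)[of i] by (cases "i \<in> {1, 2, 3, 4}") auto
      then show False
        using z(2) by auto
    qed
    have "arrive \<Phi> 1 z = z(1 := z 1 + 1)" "arrive \<Phi> 2 z = z(2 := z 2 + 1)" "arrive \<Phi> 4 z = z(4 := z 4 + 1)"
      by (rule arrive_queued; use 4 in \<open>auto simp: set_policy simp del: One_nat_def\<close>)+
    moreover have "arrive \<Phi> 3 z = z(4 := z 4 - 1)"
      by (rule arrive_matched; use 4 \<open>0 < z 4\<close> in \<open>auto simp: set_policy simp del: One_nat_def\<close>)
    ultimately have "g 1 = a 1" "g 2 = a 2" "g 3 = - a 4" "g 4 = a 4"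
      unfolding g_def using \<open>0 < z 4\<close> by (simp_all del: One_nat_def add: weighted_size_matched weighted_size_queued)
    then show ?thesis
      unfolding sum using 4 by (simp del: One_nat_def add: drift_def algebra_simps)
  qed
qed

lemma mean_step_weighted_size:
  assumes z: "z \<in> queue_states pendant" "z \<noteq> (\<lambda>_. 0)"
  shows "mean_step (weighted_size a) z = weighted_size a z + drift a z / total_rate"
proof -
  have "mean_step (weighted_size a) z - weighted_size a z = mean_step (\<lambda>x. weighted_size a x + (- weighted_size a z)) z"
    by (simp only: mean_step_add mean_step_const)
  also have "\<dots> = (\<Sum>i\<in>{1, 2, 3, 4}. rate i * (weighted_size a (arrive \<Phi> i z) - weighted_size a z)) / total_rate"
    unfolding mean_step_def sum_divide_distrib by (intro sum.cong) auto
  finally show ?thesis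
    unfolding sum_weighted_size_arrive[OF z] by simp
qed

lemma stable_if:
  assumes "0 < e" "\<forall>i. 0 \<le> a i"
    and "\<forall>z\<in>queue_states pendant. z \<noteq> (\<lambda>_. 0) \<longrightarrow> drift a z \<le> - e"
  shows "stable_queue pendant rate \<Phi>"
proof (rule stable_queueI)
  show "\<forall>z\<in>queue_states pendant. 0 \<le> weighted_size a z"
    using assms by (simp add: weighted_size_def)
  show "0 < e / total_rate"
    using assms total_rate_pos by simp
  show "\<forall>z\<in>queue_states pendant. z \<noteq> (\<lambda>_. 0) \<longrightarrow> mean_step (weighted_size a) z \<le> weighted_size a z - e / total_rate"
  proof (intro ballI impI)
    fix z :: "nat \<Rightarrow> nat" assume z: "z \<in> queue_states pendant" "z \<noteq> (\<lambda>_. 0)"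
    then have "drift a z / total_rate \<le> - e / total_rate"
      using assms(3) total_rate_pos by (intro divide_right_mono) (auto simp: less_imp_le)
    then show "mean_step (weighted_size a) z \<le> weighted_size a z - e / total_rate"
      unfolding mean_step_weighted_size[OF z] by simp
  qed
qed

lemma not_stable_if:
  assumes a: "\<forall>i. 0 \<le> a i" and i: "i \<in> {1, 2, 3, 4}" "0 < a i"
    and drift: "\<forall>z\<in>queue_states pendant. 0 \<le> drift a z"
  shows "\<not> stable_queue pendant rate \<Phi>"
proof (rule not_stable_queueI)
  show "\<forall>z\<in>queue_states pendant. 0 \<le> weighted_size a z"
    using a by (simp add: weighted_size_def)
  show "weighted_size a (\<lambda>_. 0) = 0"
    by (simp add: weighted_size_def)
  show "\<forall>z\<in>queue_states pendant. z \<noteq> (\<lambda>_. 0) \<longrightarrow> weighted_size a z \<le> mean_step (weighted_size a) z"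
  proof (intro ballI impI)
    fix z :: "nat \<Rightarrow> nat" assume z: "z \<in> queue_states pendant" "z \<noteq> (\<lambda>_. 0)"
    then have "0 \<le> drift a z / total_rate"
      using drift total_rate_pos by (intro divide_nonneg_pos) auto
    then show "weighted_size a z \<le> mean_step (weighted_size a) z"
      unfolding mean_step_weighted_size[OF z] by simp
  qed
  show "\<forall>i\<in>nodes pendant. \<forall>z\<in>queue_states pendant.
      weighted_size a (arrive \<Phi> i z) \<le> weighted_size a z + (a 1 + a 2 + a 3 + a 4)"
  proof (intro ballI)
    fix i z assume "i \<in> nodes pendant"
    then have "weighted_size a (arrive \<Phi> i z) \<le> weighted_size a z + a i" "a i \<le> a 1 + a 2 + a 3 + a 4"
      using a weighted_size_arrive_le[of a i z] by (auto simp: add_increasing add_increasing2)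
    then show "weighted_size a (arrive \<Phi> i z) \<le> weighted_size a z + (a 1 + a 2 + a 3 + a 4)"
      by simp
  qed
  show "i \<in> nodes pendant"
    using i by simp
  show "0 < weighted_size a (arrive \<Phi> i (\<lambda>_. 0))"
    using i weighted_size_queued[of i a "\<lambda>_. 0"] by (simp add: arrive_queued weighted_size_def)
qed

text \<open>Necessity is shown in this order because the first two conditions make \<open>d1\<close>
  and \<open>d2\<close> positive, on which the weights for the last one depend. The bounds of
  \<open>Ncond\<close> on class 4 are recovered in \<open>alpha_condition_imp\<close>.\<close>

lemma stable_iff:
  "stable_queue pendant rate \<Phi> \<longleftrightarrow> rate 1 < rate 2 + rate 3 \<and> rate 2 < rate 1 + rate 3 \<and>
    rate 3 < rate 1 + rate 2 + rate 4 \<and> rate 4 < alpha rate * rate 3"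
  (is "?S \<longleftrightarrow> ?c1 \<and> ?c2 \<and> ?c3 \<and> ?c4")
proof -
  define d1 d2 where "d1 = rate 2 + rate 3 - rate 1" and "d2 = rate 1 + rate 3 - rate 2"
  have inv: "inverse (alpha rate) = 1 + rate 1 / d1 + rate 2 / d2"
    by (simp add: inverse_alpha d1_def d2_def add.commute)
  note pos = rates_pos
  show ?thesis
  proof
    assume S: ?S
    have c1: ?c1
    proof (rule ccontr)
      assume "\<not> ?c1"
      then have "\<not> ?S"
        using pos by (intro not_stable_if[of "\<lambda>i. if i = 1 then 1 else 0" 1]) (auto simp: drift_def)
      then show False using S by simp
    qed
    have c2: ?c2
    proof (rule ccontr)
      assume "\<not> ?c2"
      then have "\<not> ?S"
        using pos by (intro not_stable_if[of "\<lambda>i. if i = 2 then 1 else 0" 2]) (auto simp: drift_def)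
      then show False using S by simp
    qed
    have c3: ?c3
    proof (rule ccontr)
      assume "\<not> ?c3"
      then have "\<not> ?S"
        using pos by (intro not_stable_if[of "\<lambda>i. if i = 3 then 1 else 0" 3]) (auto simp: drift_def)
      then show False using S by simp
    qed
    have d: "0 < d1" "0 < d2"
      using c1 c2 by (auto simp: d1_def d2_def)
    have alpha: "0 < alpha rate"
      using d pos inv by (subst inverse_positive_iff_positive[symmetric]) (simp add: add_pos_pos)
    have c4: ?c4
    proof (rule ccontr)
      assume "\<not> ?c4"
      then have "rate 3 \<le> rate 4 * inverse (alpha rate)"
        using alpha by (simp add: field_simps)
      also have "\<dots> = rate 4 / d1 * rate 1 + rate 4 / d2 * rate 2 + rate 4"
        unfolding inv by (simp add: algebra_simps)
      finally have "rate 3 \<le> rate 4 / d1 * rate 1 + rate 4 / d2 * rate 2 + rate 4" .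
      moreover have "rate 4 / d1 * (rate 1 - rate 2 - rate 3) + rate 4 = 0"
        "rate 4 / d2 * (rate 2 - rate 1 - rate 3) + rate 4 = 0"
        using d by (simp_all add: field_simps) (simp_all add: d1_def d2_def algebra_simps)
      ultimately have "\<not> ?S"
        using pos d
        by (intro not_stable_if[of "\<lambda>i. if i = 1 then rate 4 / d1 else if i = 2 then rate 4 / d2
              else if i = 4 then 1 else 0" 4]) (auto simp: drift_def)
      then show False using S by simp
    qed
    show "?c1 \<and> ?c2 \<and> ?c3 \<and> ?c4"
      using c1 c2 c3 c4 by blast
  next
    assume c: "?c1 \<and> ?c2 \<and> ?c3 \<and> ?c4"
    have d: "0 < d1" "0 < d2"
      using c by (auto simp: d1_def d2_def)
    have alpha: "0 < alpha rate"
      using d pos inv by (subst inverse_positive_iff_positive[symmetric]) (simp add: add_pos_pos)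
    define s where "s = alpha rate * rate 3"
    \<comment> \<open>The two entries are the rates at which V decreases while no class-3 item is
      queued and while one is.\<close>
    define e where "e = min (s - rate 4) (rate 1 + rate 2 + rate 4 - rate 3)"
    have e: "0 < e" "0 < s"
      using c pos alpha by (auto simp: e_def s_def)
    have "rate 3 = s * inverse (alpha rate)"
      using alpha by (simp add: s_def)
    also have "\<dots> = s / d1 * rate 1 + s / d2 * rate 2 + s"
      unfolding inv by (simp add: algebra_simps)
    finally have center: "s / d1 * rate 1 + s / d2 * rate 2 + 1 * (rate 4 - rate 3) = rate 4 - s"
      by simp
    have arms: "s / d1 * (rate 1 - rate 2 - rate 3) = - s" "s / d2 * (rate 2 - rate 1 - rate 3) = - s"
      using d by (simp_all add: field_simps) (simp_all add: d1_def d2_def algebra_simps)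
    define a where "a i = (if i = 1 then s / d1 else if i = 2 then s / d2 else 1)" for i :: nat
    have a: "a 1 = s / d1" "a 2 = s / d2" "a 3 = 1" "a 4 = 1"
      by (simp_all add: a_def)
    have "e \<le> s - rate 4" "e \<le> rate 1 + rate 2 + rate 4 - rate 3"
      by (simp_all add: e_def)
    then have "drift a z \<le> - e" for z
      unfolding drift_def a center arms by simp
    moreover have "\<forall>i. 0 \<le> a i"
      using d e by (simp add: a_def)
    ultimately show ?S
      using e(1) by (intro stable_if[of e a]) auto
  qed
qed

end

text \<open>With d = x - y, \<open>alpha rate * rate 3\<close> equals (w - d) (w + d) / (w + x + y).
  Neither factor exceeds w + x + y, so the quotient is at most w - d and at most w + d, hence also
  at most their average w.\<close>

lemma alpha_condition_imp:
  fixes rate :: "nat \<Rightarrow> real"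
  assumes pos: "0 < rate 1" "0 < rate 2" "0 < rate 3"
    and c: "rate 1 < rate 2 + rate 3" "rate 2 < rate 1 + rate 3" "rate 4 < alpha rate * rate 3"
  shows "rate 4 < rate 3" "rate 1 + rate 4 < rate 2 + rate 3" "rate 2 + rate 4 < rate 1 + rate 3"
proof -
  define x y w where "x = rate 1" "y = rate 2" "w = rate 3"
  have xyw: "0 < x" "0 < y" "0 < w" "x < y + w" "y < x + w"
    using assms by (simp_all add: x_y_w_def)
  have "alpha rate = (w\<^sup>2 - (x - y)\<^sup>2) / (w * (w + x + y))"
    using alpha_eq[OF pos c(1,2)] by (simp add: x_y_w_def)
  moreover have "w\<^sup>2 - (x - y)\<^sup>2 = (w - (x - y)) * (w + (x - y))"
    by (simp add: power2_eq_square algebra_simps)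
  ultimately have "alpha rate * rate 3 = (w - (x - y)) * (w + (x - y)) / (w + x + y)"
    using xyw(3) by (simp flip: x_y_w_def(3))
  moreover have "(w - (x - y)) * (w + (x - y)) \<le> (w - (x - y)) * (w + x + y)"
    "(w + (x - y)) * (w - (x - y)) \<le> (w + (x - y)) * (w + x + y)"
    using xyw by (intro mult_left_mono; simp)+
  ultimately have "alpha rate * rate 3 \<le> w - (x - y)" "alpha rate * rate 3 \<le> w + (x - y)"
    using xyw by (auto simp: pos_divide_le_eq mult.commute)
  then show "rate 4 < rate 3" "rate 1 + rate 4 < rate 2 + rate 3" "rate 2 + rate 4 < rate 1 + rate 3"
    using c(3) by (simp_all add: x_y_w_def)
qed

theorem proposition2:
  fixes rate :: "nat \<Rightarrow> real" and \<Phi> :: "nat \<Rightarrow> nat list"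
  assumes "\<forall>i\<in>nodes pendant. 0 < rate i"
    and "priority_policy pendant \<Phi>"
    and "\<Phi> 3 = [1, 2, 4] \<or> \<Phi> 3 = [2, 1, 4]"
  shows "(stable_queue pendant rate \<Phi> \<longleftrightarrow>
           rate \<in> Ncond pendant \<and> rate 4 < alpha rate * rate 3) \<and>
         (rate \<in> Ncond pendant \<longrightarrow>
           alpha rate = ((rate 3)\<^sup>2 - (rate 1 - rate 2)\<^sup>2) / (rate 3 * (rate 3 + rate 1 + rate 2)))"
proof -
  interpret pendant_queue rate \<Phi>
    using assms simple_graph_pendant by unfold_locales auto
  note pos = rates_pos
  show ?thesis
    unfolding stable_iff Ncond_pendant_iff[OF assms(1)]
    using alpha_eq[OF pos(1-3)] alpha_condition_imp[OF pos(1-3)] by blast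
qed

end
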